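(* Let $m\geq 2$. Let $Q_1,\ldots,Q_m$ be distinct smooth conics in $\mathbb{P}^2$ belonging to a hyperosculating pencil of conics with base point $p$, let $L_0$ be the common tangent line to all these conics at $p$, and let $C_0=Q_1\cup\cdots\cup Q_m$ and $C_1=C_0\cup L_0$. Let $q\in L_0$ be a point distinct from $p$ and, for $k=1,\ldots,m$, let $L_k$ be the tangent line from $q$ to the conic $Q_k$ distinct from $L_0$. Then for every $j=2,\ldots,m+1$, the conic-line arrangement $$C_j=C_1\cup L_1\cup\cdots\cup L_{j-1}:\ F_j=0$$ is a free curve of degree $d_j=2m+j$ with $r_j=\operatorname{mdr}(F_j)=j$.
   Context: A hyperosculating pencil of conics is a pencil of conics in $\mathbb{P}^2$ with exactly one base point (so that any two of its smooth members meet only at that point, with intersection multiplicity $4$). Let $S=\mathbb{C}[x,y,z]$. For a reduced plane curve $G=0$ in $\mathbb{P}^2$ with $G\in S$ homogeneous, let $D_0(G)=\{a\partial_x+b\partial_y+c\partial_z : a,b,c\in S,\ aG_x+bG_y+cG_z=0\}$, a graded $S$-module of rank 2 (a derivation has degree $r$ if $a,b,c$ are homogeneous of degree $r$). The curve $G=0$ is free if $D_0(G)$ is a free graded $S$-module, and $\operatorname{mdr}(G)=\min\{r : D_0(G)_r\neq 0\}$. *)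

theory Defs
  imports "HOL-Analysis.Analysis" "HOL-Computational_Algebra.Computational_Algebra"
begin

section \<open>The ring \<open>S = \<complex>[x,y,z]\<close>\<close>

text \<open>\<open>S\<close> is represented as \<open>\<complex>[x][y][z]\<close>: the variable \<open>x\<close> is innermost, so the coefficient of
  \<open>x\<^sup>i y\<^sup>j z\<^sup>k\<close> in \<open>G\<close> is \<open>coeff (coeff (coeff G k) j) i\<close>.\<close>

type_synonym S = "complex poly poly poly"

definition const3 :: "complex \<Rightarrow> S" where "const3 c = [:[:[:c:]:]:]"

definition vars3 :: "S ^ 3" where
  "vars3 = vector [[:[:[:0, 1:]:]:], [:[:0, 1:]:], [:0, 1:]]"

definition eval3 :: "S \<Rightarrow> complex ^ 3 \<Rightarrow> complex" where
  "eval3 G v = poly (poly (poly G [:[:v $ 3:]:]) [:v $ 2:]) (v $ 1)"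

definition grad3 :: "S \<Rightarrow> S ^ 3" where
  "grad3 G = vector [map_poly (map_poly pderiv) G, map_poly pderiv G, pderiv G]"

text \<open>The zero polynomial is homogeneous of every degree.\<close>

definition homogeneous3 :: "nat \<Rightarrow> S \<Rightarrow> bool" where
  "homogeneous3 d G \<longleftrightarrow>
     (\<forall>i j k. coeff (coeff (coeff G k) j) i \<noteq> 0 \<longrightarrow> i + j + k = d)"

section \<open>Points and curves in the projective plane\<close>

text \<open>A point of \<open>\<P>\<^sup>2\<close> is given by homogeneous coordinates (a nonzero vector, up to \<open>same_point\<close>),
  a plane curve by a nonzero form (up to \<open>same_curve\<close>).\<close>

definition same_point :: "complex ^ 3 \<Rightarrow> complex ^ 3 \<Rightarrow> bool" where
  "same_point v w \<longleftrightarrow> (\<exists>c. c \<noteq> 0 \<and> v = c *s w)"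

definition same_curve :: "S \<Rightarrow> S \<Rightarrow> bool" where
  "same_curve G H \<longleftrightarrow> (\<exists>c. c \<noteq> 0 \<and> G = const3 c * H)"

definition zero_locus :: "S \<Rightarrow> (complex ^ 3) set" where
  "zero_locus G = {v. v \<noteq> 0 \<and> eval3 G v = 0}"

definition plane_curve :: "nat \<Rightarrow> S \<Rightarrow> bool" where
  "plane_curve d G \<longleftrightarrow> G \<noteq> 0 \<and> homogeneous3 d G"

definition smooth_conic :: "S \<Rightarrow> bool" where
  "smooth_conic G \<longleftrightarrow>
     plane_curve 2 G \<and> (\<forall>v \<in> zero_locus G. \<exists>i. eval3 (grad3 G $ i) v \<noteq> 0)"

text \<open>\<open>tangent_at L G a\<close>: the curve \<open>G = 0\<close> is smooth at its point \<open>a\<close>, with tangent line \<open>L = 0\<close>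
  there, i.e. \<open>G\<^sub>x(a) x + G\<^sub>y(a) y + G\<^sub>z(a) z = 0\<close>.\<close>

definition tangent_at :: "S \<Rightarrow> S \<Rightarrow> complex ^ 3 \<Rightarrow> bool" where
  "tangent_at L G a \<longleftrightarrow>
     a \<in> zero_locus G \<and> plane_curve 1 L \<and>
     same_curve L (\<Sum>i\<in>UNIV. const3 (eval3 (grad3 G $ i) a) * vars3 $ i)"

definition tangent_line :: "S \<Rightarrow> S \<Rightarrow> bool" where
  "tangent_line L G \<longleftrightarrow> (\<exists>a. tangent_at L G a)"

definition conic_pencil :: "S set \<Rightarrow> bool" where
  "conic_pencil \<P> \<longleftrightarrow>
     (\<exists>A B. homogeneous3 2 A \<and> homogeneous3 2 B \<and>
        (\<forall>\<alpha> \<beta>. const3 \<alpha> * A + const3 \<beta> * B = 0 \<longrightarrow> \<alpha> = 0 \<and> \<beta> = 0) \<and>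
        \<P> = {const3 \<alpha> * A + const3 \<beta> * B |\<alpha> \<beta>. (\<alpha>, \<beta>) \<noteq> (0, 0)})"

definition hyperosculating_pencil :: "S set \<Rightarrow> complex ^ 3 \<Rightarrow> bool" where
  "hyperosculating_pencil \<P> p \<longleftrightarrow>
     conic_pencil \<P> \<and> p \<noteq> 0 \<and> (\<Inter>G\<in>\<P>. zero_locus G) = {v. same_point v p}"

section \<open>Free curves\<close>

text \<open>The derivation \<open>a \<partial>\<^sub>x + b \<partial>\<^sub>y + c \<partial>\<^sub>z\<close> is represented by the vector \<open>(a, b, c)\<close>.\<close>

global_interpretation S3: module "(*s) :: S \<Rightarrow> S ^ 3 \<Rightarrow> S ^ 3"
  by unfold_locales (simp_all add: vec_eq_iff algebra_simps)

definition D0 :: "S \<Rightarrow> (S ^ 3) set" where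
  "D0 G = {\<theta>. (\<Sum>i\<in>UNIV. \<theta> $ i * grad3 G $ i) = 0}"

definition homogeneous_der :: "nat \<Rightarrow> S ^ 3 \<Rightarrow> bool" where
  "homogeneous_der r \<theta> \<longleftrightarrow> (\<forall>i. homogeneous3 r (\<theta> $ i))"

definition mdr :: "S \<Rightarrow> nat" where
  "mdr G = (LEAST r. \<exists>\<theta> \<in> D0 G. \<theta> \<noteq> 0 \<and> homogeneous_der r \<theta>)"

text \<open>Free as a graded module means having a basis of homogeneous elements.\<close>

definition free_graded :: "(S ^ 3) set \<Rightarrow> bool" where
  "free_graded M \<longleftrightarrow>
     (\<exists>B. B \<subseteq> M \<and> (\<forall>\<theta>\<in>B. \<exists>r. homogeneous_der r \<theta>) \<and> S3.independent B \<and> S3.span B = M)"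

text \<open>Freeness is a notion for reduced curves, so reducedness of the equation is part of it.\<close>

definition free_curve :: "S \<Rightarrow> bool" where
  "free_curve G \<longleftrightarrow> (\<exists>d. plane_curve d G) \<and> squarefree G \<and> free_graded (D0 G)"

end

theory Submission imports Defs "HOL-Computational_Algebra.Field_as_Ring" begin

text \<open>In suitable coordinates \<open>p = (0:0:1)\<close>, \<open>q = (0:1:0)\<close>, \<open>L\<^sub>0 = X\<close>, and, up to
  constants, \<open>Q\<^sub>k = Y\<^sup>2 + X w\<^sub>k\<close> and \<open>L\<^sub>k = w\<^sub>k\<close> with \<open>w\<^sub>k = Z + t\<^sub>k X\<close> and distinct
  \<open>t\<^sub>k\<close>. Let \<open>E\<close> be the Euler derivation. The derivation \<open>\<delta> = X \<partial>\<^sub>Y - 2 Y \<partial>\<^sub>Z\<close> kills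
  \<open>X\<close> and all \<open>Q\<^sub>k\<close>, so \<open>\<eta>\<^sub>1 = (\<Prod>k<j. w\<^sub>k) \<delta>\<close> preserves the ideal of the equation \<open>F\<close>.
  With \<open>b = X^(m-1) (\<Prod>k\<le>m. w\<^sub>k)\<close> the product of all \<open>Q\<^sub>k\<close> can be written as \<open>2 Y a + X b\<close>.
  Then \<open>\<eta>\<^sub>2 = a \<partial>\<^sub>Y + b \<partial>\<^sub>Z\<close> maps each \<open>Q\<^sub>k\<close> to \<open>2 Y a + X b\<close> and each \<open>w\<^sub>k\<close> to \<open>b\<close>,
  so it preserves the ideal too. Since \<open>det (E, \<eta>\<^sub>1, \<eta>\<^sub>2)\<close> is a constant multiple of \<open>F\<close>,
  Saito's criterion shows that \<open>\<eta>\<^sub>1\<close> and \<open>\<eta>\<^sub>2\<close>, corrected by multiples of \<open>E\<close>, form a basis,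
  of degrees \<open>j \<le> 2 m - 1\<close>. The criterion also needs that no prime divides \<open>F\<close> and its gradient,
  which gives at once that \<open>F\<close> is squarefree.\<close>

no_notation fps_nth (infixl "$" 75)

subsection \<open>Substitution in polynomials\<close>

text \<open>Together with \<open>poly_map_poly_mult\<close>: substitution combined with a ring
  homomorphism on the coefficients is again a ring homomorphism. \<open>dilate\<close> is built from
  this one variable at a time.\<close>

lemma poly_map_poly_add:
  fixes h :: "'a::comm_ring_1 \<Rightarrow> 'b::comm_ring_1"
  assumes h0: "h 0 = 0" and add: "\<And>a b. h (a + b) = h a + h b"
  shows "poly (map_poly h (p + q)) x = poly (map_poly h p) x + poly (map_poly h q) x"
proof -
  have "map_poly h (p + q) = map_poly h p + map_poly h q"
    by (intro poly_eqI) (simp add: coeff_map_poly h0 add)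
  then show ?thesis by simp
qed

lemma poly_map_poly_mult:
  fixes h :: "'a::comm_ring_1 \<Rightarrow> 'b::comm_ring_1"
  assumes h0: "h 0 = 0" and add: "\<And>a b. h (a + b) = h a + h b"
    and mult: "\<And>a b. h (a * b) = h a * h b"
  shows "poly (map_poly h (p * q)) x = poly (map_poly h p) x * poly (map_poly h q) x"
proof (induction p)
  case (pCons a p)
  have "poly (map_poly h (smult a q)) x = h a * poly (map_poly h q) x"
    by (simp add: map_poly_smult h0 mult)
  then show ?case using pCons
    by (simp add: poly_map_poly_add[of h, OF h0 add] map_poly_pCons h0 algebra_simps)
qed simp

subsection \<open>Evaluation\<close>

lemma eval3_0 [simp]: "eval3 0 v = 0"
  and eval3_1 [simp]: "eval3 1 v = 1"
  and eval3_add [simp]: "eval3 (G + H) v = eval3 G v + eval3 H v"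
  and eval3_diff [simp]: "eval3 (G - H) v = eval3 G v - eval3 H v"
  and eval3_mult [simp]: "eval3 (G * H) v = eval3 G v * eval3 H v"
  and eval3_const [simp]: "eval3 (const3 c) v = c"
  by (simp_all add: eval3_def const3_def)

lemma eval3_numeral [simp]: "eval3 (numeral n) v = numeral n"
  by (simp add: eval3_def numeral_poly)

lemma vars3_nth [simp]:
  "vars3 $ 1 = [:[:[:0, 1:]:]:]" "vars3 $ 2 = [:[:0, 1:]:]" "vars3 $ 3 = [:0, 1:]"
  by (simp_all add: vars3_def)

lemma eval3_vars [simp]: "eval3 (vars3 $ i) v = v $ i"
proof -
  have "\<forall>i. eval3 (vars3 $ i) v = v $ i" by (simp add: forall_3 eval3_def)
  then show ?thesis by blast
qed

text \<open>The variables are peeled off from the inside out: \<open>x\<close> by equality of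
  polynomial functions, then \<open>y\<close> and \<open>z\<close> because a nonzero polynomial
  cannot have infinitely many constants as roots.\<close>

lemma eval3_eqI:
  assumes "\<And>v. eval3 G v = eval3 H v" shows "G = H"
proof -
  have "poly (poly (poly G [:[:c:]:]) [:b:]) a = poly (poly (poly H [:[:c:]:]) [:b:]) a" for a b c
    using assms[of "vector [a, b, c]"] by (simp add: eval3_def)
  then have "poly (poly (G - H) [:[:c:]:]) [:b:] = 0" for b c
    by (simp add: poly_eq_poly_eq_iff[symmetric] fun_eq_iff)
  moreover have "p = 0" if "\<And>b. poly p [:b:] = 0" for p :: "complex poly poly"
  proof (rule ccontr)
    assume "p \<noteq> 0"
    then have "finite (range (\<lambda>b::complex. [:b:]))"
      using that by (intro finite_subset[OF _ poly_roots_finite[of p]]) auto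
    then show False
      using finite_imageD[of "\<lambda>b::complex. [:b:]" UNIV] infinite_UNIV_char_0[where 'a=complex]
      by (auto simp: inj_on_def)
  qed
  ultimately have *: "poly (G - H) [:[:c:]:] = 0" for c by blast
  have "G - H = 0"
  proof (rule ccontr)
    assume "G - H \<noteq> 0"
    then have "finite (range (\<lambda>c::complex. [:[:c:]:]))"
      using * by (intro finite_subset[OF _ poly_roots_finite[of "G - H"]]) auto
    then show False
      using finite_imageD[of "\<lambda>c::complex. [:[:c:]:]" UNIV] infinite_UNIV_char_0[where 'a=complex]
      by (auto simp: inj_on_def)
  qed
  then show ?thesis by simp
qed

lemma const3_simps [simp]:
  "const3 0 = 0" "const3 1 = 1" "const3 a * const3 b = const3 (a * b)"
  "const3 a + const3 b = const3 (a + b)" "const3 a - const3 b = const3 (a - b)" "- const3 a = const3 (- a)"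
  by (simp_all add: const3_def one_pCons)

lemma const3_eq_iff [simp]: "const3 a = const3 b \<longleftrightarrow> a = b" "const3 a = 0 \<longleftrightarrow> a = 0"
  by (simp_all add: const3_def)

lemma const3_prod: "const3 (\<Prod>k\<in>K. f k) = (\<Prod>k\<in>K. const3 (f k))"
  by (induction K rule: infinite_finite_induct) (simp_all flip: const3_simps(3))

lemma zero_locus_mult: "zero_locus (G * H) = zero_locus G \<union> zero_locus H"
  by (auto simp: zero_locus_def)

lemma zero_locus_prod:
  "finite K \<Longrightarrow> zero_locus (\<Prod>k\<in>K. f k) = (\<Union>k\<in>K. zero_locus (f k))"
  by (induction K rule: finite_induct) (auto simp: zero_locus_mult, simp add: zero_locus_def)

subsection \<open>Derivations\<close>

lemma grad3_nth:
  "grad3 G $ 1 = map_poly (map_poly pderiv) G" "grad3 G $ 2 = map_poly pderiv G"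
  "grad3 G $ 3 = pderiv G"
  by (simp_all add: grad3_def)

lemma map_poly_add_hom:
  fixes d :: "'a::comm_ring_1 \<Rightarrow> 'b::comm_ring_1"
  assumes "d 0 = 0" and "\<And>a b. d (a + b) = d a + d b"
  shows "map_poly d (p + q) = map_poly d p + map_poly d q"
  by (intro poly_eqI) (simp add: coeff_map_poly assms)

text \<open>Gives the Leibniz rule for the partial derivatives in the inner variables, which act on
  coefficients.\<close>

lemma map_poly_derivation:
  fixes d :: "'a::comm_ring_1 \<Rightarrow> 'a"
  assumes d0: "d 0 = 0" and add: "\<And>a b. d (a + b) = d a + d b"
    and mult: "\<And>a b. d (a * b) = d a * b + a * d b"
  shows "map_poly d (p * q) = map_poly d p * q + p * map_poly d q"
proof (induction p)
  case (pCons a p)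
  have "map_poly d (smult a q) = smult (d a) q + smult a (map_poly d q)"
    by (intro poly_eqI) (simp add: coeff_map_poly d0 mult)
  then show ?case using pCons
    by (simp add: map_poly_add_hom[of d, OF d0 add] map_poly_pCons d0)
qed simp

lemma grad3_add [simp]: "grad3 (G + H) $ i = grad3 G $ i + grad3 H $ i"
proof -
  have "\<forall>i. grad3 (G + H) $ i = grad3 G $ i + grad3 H $ i"
    by (simp add: forall_3 grad3_nth map_poly_add_hom pderiv_add)
  then show ?thesis by blast
qed

lemma grad3_mult [simp]: "grad3 (G * H) $ i = grad3 G $ i * H + G * grad3 H $ i"
proof -
  have 1: "map_poly pderiv (p * q) = map_poly pderiv p * q + p * map_poly pderiv q"
    for p q :: "complex poly poly"
    by (rule map_poly_derivation) (simp_all add: pderiv_add pderiv_mult)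
  have 2: "map_poly pderiv (p * q) = map_poly pderiv p * q + p * map_poly pderiv q"
    for p q :: S
    by (rule map_poly_derivation) (simp_all add: pderiv_add pderiv_mult)
  have 3: "map_poly (map_poly pderiv) (p * q) =
    map_poly (map_poly pderiv) p * q + p * map_poly (map_poly pderiv) q" for p q :: S
    by (rule map_poly_derivation) (simp_all add: map_poly_add_hom pderiv_add 1)
  have "\<forall>i. grad3 (G * H) $ i = grad3 G $ i * H + G * grad3 H $ i"
    by (simp add: forall_3 grad3_nth 2 3 pderiv_mult add.commute mult.commute)
  then show ?thesis by blast
qed

lemma grad3_const [simp]: "grad3 (const3 c) $ i = 0"
proof -
  have "\<forall>i. grad3 (const3 c) $ i = 0"
    by (simp add: forall_3 grad3_nth const3_def map_poly_pCons)
  then show ?thesis by blast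
qed

lemma grad3_vars [simp]: "grad3 (vars3 $ j) $ i = (if i = j then 1 else 0)"
proof -
  have "\<forall>j i. grad3 (vars3 $ j) $ i = (if i = j then 1 else 0)"
    by (simp add: forall_3 grad3_nth map_poly_pCons pderiv_pCons one_pCons)
  then show ?thesis by blast
qed

lemma grad3_0 [simp]: "grad3 0 $ i = 0"
  using grad3_const[of 0 i] by simp

lemma grad3_1 [simp]: "grad3 1 $ i = 0"
  using grad3_const[of 1 i] by simp

definition der :: "S ^ 3 \<Rightarrow> S \<Rightarrow> S" where
  "der \<theta> G = (\<Sum>i\<in>UNIV. \<theta> $ i * grad3 G $ i)"

lemma D0_iff: "\<theta> \<in> D0 G \<longleftrightarrow> der \<theta> G = 0"
  by (simp add: D0_def der_def)

lemma der_0 [simp]: "der \<theta> 0 = 0"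
  and der_1 [simp]: "der \<theta> 1 = 0"
  and der_const [simp]: "der \<theta> (const3 c) = 0"
  and der_add: "der \<theta> (G + H) = der \<theta> G + der \<theta> H"
  and der_mult: "der \<theta> (G * H) = der \<theta> G * H + G * der \<theta> H"
  and der_vec_add: "der (\<theta> + \<eta>) G = der \<theta> G + der \<eta> G"
  and der_vec_diff: "der (\<theta> - \<eta>) G = der \<theta> G - der \<eta> G"
  and der_scale: "der (f *s \<theta>) G = f * der \<theta> G"
  by (simp_all add: der_def sum_3 algebra_simps)

subsection \<open>Homogeneity\<close>

text \<open>The substitution \<open>G(x, y, z) \<mapsto> G(T x, T y, T z)\<close>, with values in \<open>S[T]\<close>. It turns the grading of \<open>S\<close> into the degree in \<open>T\<close>.\<close>

definition dilate1 :: "complex poly \<Rightarrow> S poly" where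
  "dilate1 u = poly (map_poly (\<lambda>c. [:const3 c:]) u) (monom (vars3 $ 1) 1)"

definition dilate2 :: "complex poly poly \<Rightarrow> S poly" where
  "dilate2 u = poly (map_poly dilate1 u) (monom (vars3 $ 2) 1)"

definition dilate :: "S \<Rightarrow> S poly" where
  "dilate G = poly (map_poly dilate2 G) (monom (vars3 $ 3) 1)"

lemma dilate1_hom: "dilate1 0 = 0" "dilate1 (p + q) = dilate1 p + dilate1 q"
  "dilate1 (p * q) = dilate1 p * dilate1 q"
  unfolding dilate1_def by (simp, rule poly_map_poly_add, simp_all, rule poly_map_poly_mult)
    (simp_all add: mult.commute)

lemma dilate2_hom: "dilate2 0 = 0" "dilate2 (p + q) = dilate2 p + dilate2 q"
  "dilate2 (p * q) = dilate2 p * dilate2 q"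
  unfolding dilate2_def using dilate1_hom
  by (simp, intro poly_map_poly_add, simp_all, intro poly_map_poly_mult) simp_all

lemma dilate_0 [simp]: "dilate 0 = 0"
  and dilate_add: "dilate (p + q) = dilate p + dilate q"
  and dilate_mult: "dilate (p * q) = dilate p * dilate q"
  unfolding dilate_def using dilate2_hom
  by (simp, intro poly_map_poly_add, simp_all, intro poly_map_poly_mult) simp_all

lemma coeff_dilate1:
  "coeff (coeff (coeff (coeff (dilate1 u) n) k) j) i =
    (if k = 0 \<and> j = 0 \<and> i = n then coeff u i else 0)"
proof (induction u arbitrary: n i)
  case (pCons a u)
  have "dilate1 (pCons a u) = [:const3 a:] + monom (vars3 $ 1) 1 * dilate1 u"
    by (simp add: dilate1_def map_poly_pCons)
  then show ?case using pCons.IH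
    by (auto simp: const3_def coeff_monom_mult coeff_pCons split: nat.splits)
qed (simp add: dilate1_hom)

lemma coeff_dilate2:
  "coeff (coeff (coeff (coeff (dilate2 u) n) k) j) i =
    (if k = 0 \<and> i + j = n then coeff (coeff u j) i else 0)"
proof (induction u arbitrary: n j)
  case (pCons a u)
  have "dilate2 (pCons a u) = dilate1 a + monom (vars3 $ 2) 1 * dilate2 u"
    by (simp add: dilate2_def map_poly_pCons dilate1_hom)
  then show ?case using pCons.IH
    by (auto simp: coeff_dilate1 coeff_monom_mult coeff_pCons split: nat.splits)
qed (simp add: dilate2_hom)

lemma coeff_dilate:
  "coeff (coeff (coeff (coeff (dilate G) n) k) j) i =
    (if i + j + k = n then coeff (coeff (coeff G k) j) i else 0)"
proof (induction G arbitrary: n k)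
  case (pCons a u)
  have "dilate (pCons a u) = dilate2 a + monom (vars3 $ 3) 1 * dilate u"
    by (simp add: dilate_def map_poly_pCons dilate2_hom)
  then show ?case using pCons.IH
    by (auto simp: coeff_dilate2 coeff_monom_mult coeff_pCons split: nat.splits)
qed simp

text \<open>The coefficient of \<open>T^n\<close> in \<open>dilate G\<close> is the part of
  \<open>G\<close> of total degree \<open>n\<close>. Homogeneity thus becomes an equation that the
  ring homomorphism \<open>dilate\<close> carries through sums, products and cancellation.\<close>

lemma homogeneous3_iff_dilate: "homogeneous3 d G \<longleftrightarrow> dilate G = monom G d"
proof
  assume "homogeneous3 d G"
  then show "dilate G = monom G d"
    by (intro poly_eqI) (auto simp: homogeneous3_def coeff_dilate coeff_monom)
next
  assume *: "dilate G = monom G d"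
  show "homogeneous3 d G" unfolding homogeneous3_def
  proof (intro allI impI)
    fix i j k assume nz: "coeff (coeff (coeff G k) j) i \<noteq> 0"
    have "coeff (coeff (coeff (coeff (dilate G) d) k) j) i = coeff (coeff (coeff G k) j) i"
      by (simp add: *)
    then show "i + j + k = d" using nz by (simp add: coeff_dilate split: if_splits)
  qed
qed

lemma homogeneous3_0 [simp]: "homogeneous3 d 0"
  by (simp add: homogeneous3_def)

lemma homogeneous3_const [simp]: "homogeneous3 0 (const3 c)"
  by (auto simp: homogeneous3_def const3_def coeff_pCons split: nat.splits)

lemma homogeneous3_1 [simp]: "homogeneous3 0 1"
  using homogeneous3_const[of 1] by simp

lemma homogeneous3_vars [simp]: "homogeneous3 1 (vars3 $ i)"
proof -
  have "\<forall>i. homogeneous3 1 (vars3 $ i)"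
    by (auto simp: forall_3 homogeneous3_def coeff_pCons split: nat.splits)
  then show ?thesis by blast
qed

lemma homogeneous3_add:
  "homogeneous3 d G \<Longrightarrow> homogeneous3 d H \<Longrightarrow> homogeneous3 d (G + H)"
  by (simp add: homogeneous3_iff_dilate dilate_add add_monom)

lemma homogeneous3_uminus: "homogeneous3 d G \<Longrightarrow> homogeneous3 d (- G)"
  by (simp add: homogeneous3_def)

lemma homogeneous3_diff:
  "homogeneous3 d G \<Longrightarrow> homogeneous3 d H \<Longrightarrow> homogeneous3 d (G - H)"
  using homogeneous3_add[of d G "- H"] homogeneous3_uminus by simp

lemma homogeneous3_mult:
  "homogeneous3 d G \<Longrightarrow> homogeneous3 e H \<Longrightarrow> homogeneous3 (d + e) (G * H)"
  by (simp add: homogeneous3_iff_dilate dilate_mult mult_monom)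

lemma homogeneous3_const_mult:
  "homogeneous3 d G \<Longrightarrow> homogeneous3 d (const3 c * G)"
  using homogeneous3_mult[of 0 "const3 c" d G] by simp

lemma homogeneous3_power: "homogeneous3 d G \<Longrightarrow> homogeneous3 (n * d) (G ^ n)"
  by (induction n) (auto intro: homogeneous3_mult)

lemma homogeneous3_prod:
  assumes "finite K" and "\<And>k. k \<in> K \<Longrightarrow> homogeneous3 d (f k)"
  shows "homogeneous3 (card K * d) (\<Prod>k\<in>K. f k)"
  using assms by (induction K) (auto intro: homogeneous3_mult)

lemma homogeneous3_sum:
  assumes "\<And>k. k \<in> K \<Longrightarrow> homogeneous3 d (f k)"
  shows "homogeneous3 d (\<Sum>k\<in>K. f k)"
  using assms by (induction K rule: infinite_finite_induct) (auto intro: homogeneous3_add)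

text \<open>The ring \<open>S[T]\<close> is a domain, so the monomial coming from \<open>G\<close>
  cancels.\<close>

lemma homogeneous3_cancel:
  assumes "homogeneous3 d G" "G \<noteq> 0" and GH: "homogeneous3 (d + e) (G * H)"
  shows "homogeneous3 e H"
proof -
  have "monom G d * dilate H = monom (G * H) (d + e)"
    using assms by (simp add: homogeneous3_iff_dilate dilate_mult)
  also have "\<dots> = monom G d * monom H e" by (simp add: mult_monom)
  finally show ?thesis using \<open>G \<noteq> 0\<close>
    by (simp add: homogeneous3_iff_dilate)
qed

text \<open>For nonzero \<open>\<alpha>\<close> the degree in \<open>T\<close> of
  \<open>dilate (\<alpha> * G)\<close> is at least \<open>e\<close>, whereas homogeneity of the
  product makes it \<open>n\<close>.\<close>

lemma homogeneous3_mult_degree_less: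
  assumes "homogeneous3 e G" "homogeneous3 n (\<alpha> * G)" "n < e" "G \<noteq> 0"
  shows "\<alpha> = 0"
proof (rule ccontr)
  assume \<alpha>: "\<alpha> \<noteq> 0"
  have eq: "dilate \<alpha> * monom G e = monom (\<alpha> * G) n"
    using assms by (simp add: homogeneous3_iff_dilate dilate_mult)
  then have "dilate \<alpha> \<noteq> 0" using \<alpha> \<open>G \<noteq> 0\<close> by auto
  then have "degree (dilate \<alpha> * monom G e) = degree (dilate \<alpha>) + e"
    using \<open>G \<noteq> 0\<close> by (simp add: degree_mult_eq degree_monom_eq)
  moreover have "degree (monom (\<alpha> * G) n) = n" using \<alpha> \<open>G \<noteq> 0\<close> by (simp add: degree_monom_eq)
  ultimately show False using eq \<open>n < e\<close> by simp
qed

lemma homogeneous3_grad: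
  assumes "homogeneous3 (Suc d) G" shows "homogeneous3 d (grad3 G $ i)"
proof -
  have [simp]: "coeff (of_nat n * p) k = of_nat n * coeff p k" for n k and p :: "'a::comm_ring_1 poly"
    by (simp add: of_nat_poly)
  have eq: "coeff (coeff (coeff (grad3 G $ 1) k) j) i = of_nat (Suc i) * coeff (coeff (coeff G k) j) (Suc i)"
    "coeff (coeff (coeff (grad3 G $ 2) k) j) i = of_nat (Suc j) * coeff (coeff (coeff G k) (Suc j)) i"
    "coeff (coeff (coeff (grad3 G $ 3) k) j) i = of_nat (Suc k) * coeff (coeff (coeff G (Suc k)) j) i"
    for k j i
    by (simp_all add: grad3_nth coeff_map_poly coeff_pderiv del: of_nat_Suc)
  have "\<forall>i. homogeneous3 d (grad3 G $ i)"
    using assms unfolding forall_3 homogeneous3_def eq mult_eq_0_iff of_nat_eq_0_iff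
    by fastforce
  then show ?thesis by blast
qed

text \<open>Differentiating in a variable and multiplying by it scales each coefficient by the
  exponent of that variable, and the three exponents add up to \<open>d\<close>.\<close>

lemma euler_identity:
  assumes "homogeneous3 d G" shows "der vars3 G = const3 (of_nat d) * G"
proof -
  have 1: "coeff (coeff (coeff (vars3 $ 1 * grad3 G $ 1) k) j) i = of_nat i * coeff (coeff (coeff G k) j) i"
   and 2: "coeff (coeff (coeff (vars3 $ 2 * grad3 G $ 2) k) j) i = of_nat j * coeff (coeff (coeff G k) j) i"
   and 3: "coeff (coeff (coeff (vars3 $ 3 * grad3 G $ 3) k) j) i = of_nat k * coeff (coeff (coeff G k) j) i"
    for i j k
    by (simp_all add: grad3_nth coeff_map_poly coeff_pderiv coeff_pCons of_nat_poly split: nat.splits)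
  show ?thesis
  proof (intro poly_eqI)
    fix k j i
    have "coeff (coeff (coeff (der vars3 G) k) j) i = of_nat (i + j + k) * coeff (coeff (coeff G k) j) i"
      unfolding der_def sum_3 by (simp only: coeff_add 1 2 3 of_nat_add ring_distribs)
    also have "\<dots> = of_nat d * coeff (coeff (coeff G k) j) i"
      using assms unfolding homogeneous3_def by (cases "coeff (coeff (coeff G k) j) i = 0") auto
    also have "\<dots> = coeff (coeff (coeff (const3 (of_nat d) * G) k) j) i"
      by (simp add: const3_def)
    finally show "coeff (coeff (coeff (der vars3 G) k) j) i = coeff (coeff (coeff (const3 (of_nat d) * G) k) j) i" .
  qed
qed

subsection \<open>Saito's criterion\<close>

text \<open>Stated over an arbitrary commutative ring, since it is applied both to derivations over
  \<open>S\<close> and to complex vectors.\<close>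

definition dot3 :: "'a::comm_ring_1 ^ 3 \<Rightarrow> 'a ^ 3 \<Rightarrow> 'a" where
  "dot3 u v = u $ 1 * v $ 1 + u $ 2 * v $ 2 + u $ 3 * v $ 3"

definition cross :: "'a::comm_ring_1 ^ 3 \<Rightarrow> 'a ^ 3 \<Rightarrow> 'a ^ 3" where
  "cross u v = vector [u $ 2 * v $ 3 - u $ 3 * v $ 2, u $ 3 * v $ 1 - u $ 1 * v $ 3,
     u $ 1 * v $ 2 - u $ 2 * v $ 1]"

lemma cross_nth:
  "cross u v $ 1 = u $ 2 * v $ 3 - u $ 3 * v $ 2"
  "cross u v $ 2 = u $ 3 * v $ 1 - u $ 1 * v $ 3"
  "cross u v $ 3 = u $ 1 * v $ 2 - u $ 2 * v $ 1"
  by (simp_all add: cross_def)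

lemmas vec3_simps = vec_eq_iff forall_3 cross_nth dot3_def

lemma cross_self [simp]: "cross u u = 0"
  and cross_0_left [simp]: "cross 0 u = 0"
  and cross_add_left: "cross (u + u') v = cross u v + cross u' v"
  and cross_diff_left: "cross (u - u') v = cross u v - cross u' v"
  and cross_scale_left: "cross (c *s u) v = c *s cross u v"
  and cross_swap: "cross u v = - cross v u"
  by (simp_all add: vec3_simps algebra_simps)

text \<open>\<open>v \<times> (g \<times> (s \<times> t))\<close> expanded in two ways.\<close>

lemma cross_expansion:
  "dot3 v (cross s t) *s g =
    dot3 v g *s cross s t + dot3 g t *s cross v s - dot3 g s *s cross v t"
  by (simp add: vec3_simps algebra_simps)

text \<open>A nonzero \<open>w\<close> parallel to both \<open>s\<close> and \<open>t\<close> would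
  make these proportional over the fraction field; multiplying by the square of a nonzero entry of
  \<open>w\<close> avoids fractions.\<close>

lemma cross_zero_cases:
  fixes w s t :: "'a::idom ^ 3"
  assumes "cross w s = 0" "cross w t = 0" "cross s t \<noteq> 0"
  shows "w = 0"
proof (rule ccontr)
  assume "w \<noteq> 0"
  then obtain k where k: "w $ k \<noteq> 0" by (auto simp: vec_eq_iff)
  have s: "\<forall>i k. w $ k * s $ i = w $ i * s $ k" and t: "\<forall>i k. w $ k * t $ i = w $ i * t $ k"
    using assms(1,2) by (auto simp: vec3_simps algebra_simps)
  have "w $ k * w $ k * (s $ i * t $ j - s $ j * t $ i) = 0" for i j
  proof -
    have "w $ k * w $ k * (s $ i * t $ j - s $ j * t $ i)
      = (w $ k * s $ i) * (w $ k * t $ j) - (w $ k * s $ j) * (w $ k * t $ i)"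
      by (simp add: algebra_simps)
    also have "\<dots> = (w $ i * s $ k) * (w $ j * t $ k) - (w $ j * s $ k) * (w $ i * t $ k)"
      using s t by metis
    also have "\<dots> = 0" by (simp add: algebra_simps)
    finally show ?thesis .
  qed
  then have "s $ i * t $ j - s $ j * t $ i = 0" for i j
    using k by (metis mult_eq_0_iff)
  then have "cross s t = 0" by (simp add: vec3_simps)
  then show False using assms(3) by simp
qed

lemma der_eq_dot3: "der \<theta> G = dot3 \<theta> (grad3 G)"
  by (simp add: der_def dot3_def sum_3)

lemma dot3_commute: "dot3 u v = dot3 v u"
  by (simp add: dot3_def mult.commute)

lemma dot3_add_left: "dot3 (u + v) w = dot3 u w + dot3 v w"
  and dot3_scale_left: "dot3 (k *s u) w = k * dot3 u w"
  by (simp_all add: dot3_def algebra_simps)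

text \<open>For a form of positive degree this says that the singular locus contains no curve; it is
  the shape in which reducedness enters Saito's criterion.\<close>

definition gradient_primitive :: "S \<Rightarrow> bool" where
  "gradient_primitive F \<longleftrightarrow> (\<forall>g. prime_elem g \<longrightarrow> (\<exists>i. \<not> g dvd grad3 F $ i))"

text \<open>\<open>f\<close> divides the gcd of the \<open>e * grad3 F $ i\<close>, which is
  \<open>e\<close> times the gcd of the partial derivatives, and the latter is a unit.\<close>

lemma dvd_of_dvd_mult_grad:
  assumes "gradient_primitive F" "grad3 F \<noteq> 0" and dvd: "\<And>i. f dvd e * grad3 F $ i"
  shows "f dvd e"
proof -
  define G where "G = grad3 F"
  define g where "g = gcd (G $ 1) (gcd (G $ 2) (G $ 3))"
  have g_dvd: "\<forall>i. g dvd G $ i"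
    by (simp add: forall_3 g_def) (meson dvd_trans gcd_dvd1 gcd_dvd2)
  have "g \<noteq> 0" using assms(2) by (auto simp: g_def G_def vec_eq_iff forall_3)
  have "is_unit g"
  proof (rule ccontr)
    assume "\<not> is_unit g"
    then obtain p where "p dvd g" "prime p" using prime_divisor_exists[OF \<open>g \<noteq> 0\<close>] by blast
    then show False using assms(1) g_dvd dvd_trans unfolding gradient_primitive_def G_def
      by (metis prime_imp_prime_elem)
  qed
  have "f dvd gcd (e * G $ 1) (gcd (e * G $ 2) (e * G $ 3))"
    using dvd by (simp add: G_def)
  then have "f dvd e * g"
    by (simp add: gcd_mult_left g_def gcd_mult_distrib')
  then show ?thesis using \<open>is_unit g\<close> by (simp add: dvd_mult_unit_iff)
qed

lemma D0_subspace: "S3.subspace (D0 F)"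
  by (rule S3.subspaceI) (auto simp: D0_iff der_vec_add der_scale, simp add: der_def)

text \<open>The triple product in \<open>det\<close> is the determinant of the Euler derivation,
  \<open>\<theta>\<^sub>1\<close> and \<open>\<theta>\<^sub>2\<close>. The degree of
  \<open>F\<close> is a successor, so that \<open>n\<close> is the degree of its gradient and
  Euler's identity can be divided by \<open>Suc n\<close>.\<close>

locale saito =
  fixes F :: S and \<theta>\<^sub>1 \<theta>\<^sub>2 :: "S ^ 3" and n r\<^sub>1 r\<^sub>2 :: nat and \<kappa> :: complex
  assumes nz: "F \<noteq> 0" and hom: "homogeneous3 (Suc n) F"
    and in_D0: "\<theta>\<^sub>1 \<in> D0 F" "\<theta>\<^sub>2 \<in> D0 F"
    and hom_der: "homogeneous_der r\<^sub>1 \<theta>\<^sub>1" "homogeneous_der r\<^sub>2 \<theta>\<^sub>2"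
    and degrees: "r\<^sub>1 + r\<^sub>2 = n"
    and det: "dot3 vars3 (cross \<theta>\<^sub>1 \<theta>\<^sub>2) = const3 \<kappa> * F" "\<kappa> \<noteq> 0"
    and primitive: "gradient_primitive F"
begin

abbreviation "c \<equiv> const3 (of_nat (Suc n))"

lemma c_nz: "c \<noteq> 0" by (simp del: of_nat_Suc)

lemma euler: "dot3 vars3 (grad3 F) = c * F"
  using euler_identity[OF hom] by (simp add: der_eq_dot3)

lemma grad_nz: "grad3 F \<noteq> 0"
  using euler c_nz nz by (auto simp: dot3_def)

text \<open>In \<open>cross_expansion\<close> with the Euler derivation as \<open>v\<close>, the
  last two terms vanish because \<open>s\<close> and \<open>t\<close> kill \<open>F\<close>, and the
  first is given by Euler's identity.\<close>

lemma cross_D0: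
  assumes "s \<in> D0 F" "t \<in> D0 F"
  shows "dot3 vars3 (cross s t) *s grad3 F = (c * F) *s cross s t"
  using cross_expansion[of vars3 s t "grad3 F"] assms
  by (simp add: euler D0_iff der_eq_dot3 dot3_commute[of "grad3 F"])

lemma cross_basis: "cross \<theta>\<^sub>1 \<theta>\<^sub>2 = const3 (\<kappa> / of_nat (Suc n)) *s grad3 F"
proof -
  have "F * (const3 \<kappa> * grad3 F $ i) = F * (c * cross \<theta>\<^sub>1 \<theta>\<^sub>2 $ i)" for i
    using arg_cong[OF cross_D0[OF in_D0], of "\<lambda>v. v $ i"] unfolding det(1)
    by (simp only: vector_smult_component ac_simps)
  then have *: "const3 \<kappa> * grad3 F $ i = c * cross \<theta>\<^sub>1 \<theta>\<^sub>2 $ i" for i using nz by simp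
  have "cross \<theta>\<^sub>1 \<theta>\<^sub>2 $ i = const3 (1 / of_nat (Suc n)) * (c * cross \<theta>\<^sub>1 \<theta>\<^sub>2 $ i)" for i
    by (simp add: mult.assoc[symmetric] del: of_nat_Suc)
  also have "\<dots> i = const3 (\<kappa> / of_nat (Suc n)) * grad3 F $ i" for i
    unfolding *[symmetric] by (simp add: mult.assoc[symmetric] del: of_nat_Suc)
  finally show ?thesis by (simp add: vec_eq_iff)
qed

lemma cross_basis_nz: "cross \<theta>\<^sub>1 \<theta>\<^sub>2 \<noteq> 0"
  using grad_nz det(2) unfolding cross_basis by (auto simp: vec_eq_iff simp del: of_nat_Suc)

text \<open>Both derivations are orthogonal to the gradient, so their cross product is proportional
  to it over the fraction field; primitivity of the gradient makes the factor a polynomial.\<close>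

lemma cross_multiple:
  assumes "s \<in> D0 F" "t \<in> D0 F"
  shows "\<exists>\<alpha>. cross s t = \<alpha> *s grad3 F"
proof -
  define e where "e = dot3 vars3 (cross s t)"
  have eG: "e * grad3 F $ i = F * (c * cross s t $ i)" for i
    using arg_cong[OF cross_D0[OF assms], of "\<lambda>v. v $ i"]
    by (simp only: vector_smult_component e_def ac_simps)
  have "F dvd e" using dvd_of_dvd_mult_grad[OF primitive grad_nz] eG by (metis dvd_triv_left)
  then obtain \<alpha> where "e = F * \<alpha>" by auto
  then have "\<alpha> * grad3 F $ i = c * cross s t $ i" for i
    using eG[of i] nz by (simp add: mult.assoc)
  then have "const3 (1 / of_nat (Suc n)) * (\<alpha> * grad3 F $ i) = cross s t $ i" for i
    by (simp add: mult.assoc[symmetric] del: of_nat_Suc)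
  then have "cross s t = (const3 (1 / of_nat (Suc n)) * \<alpha>) *s grad3 F"
    by (simp add: vec_eq_iff mult.assoc del: of_nat_Suc)
  then show ?thesis ..
qed

text \<open>Cramer's rule: the cross products of \<open>s\<close> with
  \<open>\<theta>\<^sub>2\<close> and \<open>\<theta>\<^sub>1\<close>, compared with
  \<open>cross \<theta>\<^sub>1 \<theta>\<^sub>2\<close>, give the coefficients. The remainder
  \<open>w\<close> is parallel to both basis elements and hence zero.\<close>

lemma decompose:
  assumes "s \<in> D0 F"
  shows "\<exists>a b. s = a *s \<theta>\<^sub>1 + b *s \<theta>\<^sub>2"
proof -
  define k where "k = \<kappa> / of_nat (Suc n)"
  have k: "k \<noteq> 0" using det(2) by (simp add: k_def del: of_nat_Suc)
  have c12: "cross \<theta>\<^sub>1 \<theta>\<^sub>2 = const3 k *s grad3 F" by (simp add: cross_basis k_def)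
  obtain \<alpha> \<beta> where \<alpha>: "cross s \<theta>\<^sub>2 = \<alpha> *s grad3 F" and \<beta>: "cross s \<theta>\<^sub>1 = \<beta> *s grad3 F"
    using cross_multiple assms in_D0 by meson
  define a b where "a = const3 (1 / k) * \<alpha>" and "b = const3 (1 / k) * (- \<beta>)"
  define w where "w = s - a *s \<theta>\<^sub>1 - b *s \<theta>\<^sub>2"
  have inv: "f * const3 k = g" if "f = const3 (1 / k) * g" for f g
  proof -
    have "f * const3 k = (const3 (1 / k) * const3 k) * g" unfolding that by (simp only: ac_simps)
    then show ?thesis using k by simp
  qed
  have ak: "a * const3 k = \<alpha>" and bk: "b * const3 k = - \<beta>"
    by (rule inv; simp add: a_def b_def)+
  have "cross w \<theta>\<^sub>2 = 0"
    by (simp add: w_def cross_diff_left cross_scale_left \<alpha> c12 ak S3.scale_scale)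
  moreover have "cross w \<theta>\<^sub>1 = 0"
    by (simp add: w_def cross_diff_left cross_scale_left \<beta> cross_swap[of \<theta>\<^sub>2 \<theta>\<^sub>1] c12 bk
      S3.scale_scale S3.scale_minus_right)
  ultimately have "w = 0" using cross_zero_cases cross_basis_nz by blast
  then have "s = a *s \<theta>\<^sub>1 + b *s \<theta>\<^sub>2" by (simp add: w_def algebra_simps)
  then show ?thesis by blast
qed

lemma independent: "a *s \<theta>\<^sub>1 + b *s \<theta>\<^sub>2 = 0 \<Longrightarrow> a = 0 \<and> b = 0"
proof -
  assume *: "a *s \<theta>\<^sub>1 + b *s \<theta>\<^sub>2 = 0"
  have "cross (a *s \<theta>\<^sub>1 + b *s \<theta>\<^sub>2) \<theta>\<^sub>2 = a *s cross \<theta>\<^sub>1 \<theta>\<^sub>2"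
    "cross (a *s \<theta>\<^sub>1 + b *s \<theta>\<^sub>2) \<theta>\<^sub>1 = - b *s cross \<theta>\<^sub>1 \<theta>\<^sub>2"
    by (simp_all add: cross_add_left cross_scale_left cross_swap[of \<theta>\<^sub>2 \<theta>\<^sub>1])
  then have "a *s cross \<theta>\<^sub>1 \<theta>\<^sub>2 = 0" "- b *s cross \<theta>\<^sub>1 \<theta>\<^sub>2 = 0"
    unfolding * cross_0_left by metis+
  then show ?thesis using cross_basis_nz by (auto simp: vec_eq_iff)
qed

lemma basis_distinct: "\<theta>\<^sub>1 \<noteq> \<theta>\<^sub>2"
  using cross_basis_nz by auto

lemma free: "free_graded (D0 F)"
  unfolding free_graded_def
proof (intro exI[of _ "{\<theta>\<^sub>1, \<theta>\<^sub>2}"] conjI)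
  show "{\<theta>\<^sub>1, \<theta>\<^sub>2} \<subseteq> D0 F" using in_D0 by simp
  show "\<forall>\<theta>\<in>{\<theta>\<^sub>1, \<theta>\<^sub>2}. \<exists>r. homogeneous_der r \<theta>" using hom_der by auto
  show "S3.independent {\<theta>\<^sub>1, \<theta>\<^sub>2}"
    using independent basis_distinct by (auto simp: S3.dependent_finite)
  show "S3.span {\<theta>\<^sub>1, \<theta>\<^sub>2} = D0 F"
  proof
    show "S3.span {\<theta>\<^sub>1, \<theta>\<^sub>2} \<subseteq> D0 F"
      using in_D0 D0_subspace by (intro S3.span_minimal) auto
    show "D0 F \<subseteq> S3.span {\<theta>\<^sub>1, \<theta>\<^sub>2}"
    proof
      fix s assume "s \<in> D0 F"
      then obtain a b where "s = a *s \<theta>\<^sub>1 + b *s \<theta>\<^sub>2" using decompose by blast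
      then show "s \<in> S3.span {\<theta>\<^sub>1, \<theta>\<^sub>2}"
        by (simp add: S3.span_add S3.span_scale S3.span_base)
    qed
  qed
qed

lemma homogeneous_cross:
  assumes "homogeneous_der r s" "homogeneous_der r' t"
  shows "homogeneous3 (r + r') (cross s t $ i)"
proof -
  have "\<forall>i. homogeneous3 (r + r') (cross s t $ i)"
    using assms unfolding forall_3 cross_nth homogeneous_der_def
    by (intro conjI homogeneous3_diff homogeneous3_mult) auto
  then show ?thesis by blast
qed

text \<open>For \<open>s\<close> of degree below \<open>r\<^sub>1\<close>, the cross products with
  \<open>\<theta>\<^sub>1\<close> and \<open>\<theta>\<^sub>2\<close> have degree below
  \<open>n\<close>. Being multiples of the gradient, which has degree \<open>n\<close>, they vanish,
  and so does \<open>s\<close>.\<close>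

lemma mdr_eq:
  assumes "r\<^sub>1 \<le> r\<^sub>2"
  shows "mdr F = r\<^sub>1"
  unfolding mdr_def
proof (rule Least_equality)
  have "\<theta>\<^sub>1 \<noteq> 0" using independent[of 1 0] by auto
  then show "\<exists>\<theta>\<in>D0 F. \<theta> \<noteq> 0 \<and> homogeneous_der r\<^sub>1 \<theta>" using in_D0 hom_der by blast
next
  fix r assume "\<exists>\<theta>\<in>D0 F. \<theta> \<noteq> 0 \<and> homogeneous_der r \<theta>"
  then obtain s where s: "s \<in> D0 F" "s \<noteq> 0" "homogeneous_der r s" by blast
  show "r\<^sub>1 \<le> r"
  proof (rule ccontr)
    assume r: "\<not> r\<^sub>1 \<le> r"
    obtain i where i: "grad3 F $ i \<noteq> 0" using grad_nz by (auto simp: vec_eq_iff)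
    have "cross s t = 0" if t: "t \<in> D0 F" "homogeneous_der r' t" "r + r' < n" for t r'
    proof -
      obtain \<alpha> where \<alpha>: "cross s t = \<alpha> *s grad3 F" using cross_multiple s t by blast
      have "homogeneous3 (r + r') (\<alpha> * grad3 F $ i)"
        using homogeneous_cross[OF s(3) t(2), of i] by (simp add: \<alpha>)
      then have "\<alpha> = 0" using homogeneous3_mult_degree_less[OF homogeneous3_grad[OF hom]] t(3) i by blast
      then show ?thesis by (simp add: \<alpha>)
    qed
    from this[OF in_D0(1) hom_der(1)] this[OF in_D0(2) hom_der(2)]
    have "cross s \<theta>\<^sub>1 = 0" "cross s \<theta>\<^sub>2 = 0"
      using r degrees assms by simp_all
    then show False using cross_zero_cases cross_basis_nz s(2) by blast
  qed
qed

end

section \<open>From derivations preserving the ideal of \<open>F\<close> to elements of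
  \<open>D0 F\<close>\<close>

lemma dvd_der_mult:
  "f dvd der \<theta> f \<Longrightarrow> g dvd der \<theta> g \<Longrightarrow> f * g dvd der \<theta> (f * g)"
  by (simp add: der_mult mult_dvd_mono)

lemma dvd_der_prod:
  assumes "\<And>k. k \<in> K \<Longrightarrow> f k dvd der \<theta> (f k)"
  shows "(\<Prod>k\<in>K. f k) dvd der \<theta> (\<Prod>k\<in>K. f k)"
  using assms by (induction K rule: infinite_finite_induct) (simp_all add: dvd_der_mult)

text \<open>If \<open>\<eta>\<close> multiplies \<open>F\<close> by \<open>h\<close>, then so does
  \<open>h / (n + 1)\<close> times the Euler derivation, and the difference kills \<open>F\<close>.
  The degree is a successor because \<open>h\<close> has degree one less than
  \<open>\<eta>\<close>.\<close>

lemma euler_correction: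
  assumes hom: "homogeneous3 (Suc n) F" "F \<noteq> 0" and \<eta>: "homogeneous_der (Suc r) \<eta>"
    and dvd: "F dvd der \<eta> F"
  shows "\<exists>f. \<eta> - f *s vars3 \<in> D0 F \<and> homogeneous_der (Suc r) (\<eta> - f *s vars3)"
proof -
  obtain h where h: "der \<eta> F = F * h" using dvd by auto
  have "homogeneous3 (Suc r + n) (der \<eta> F)"
    unfolding der_def using \<eta> homogeneous3_grad[OF hom(1)]
    by (intro homogeneous3_sum homogeneous3_mult) (auto simp: homogeneous_der_def)
  then have "homogeneous3 r h"
    using hom h homogeneous3_cancel[of "Suc n" F r h] by (simp add: add.commute)
  define f where "f = const3 (1 / of_nat (Suc n)) * h"
  have f: "homogeneous3 r f" unfolding f_def using \<open>homogeneous3 r h\<close> by (rule homogeneous3_const_mult)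
  have "f * (const3 (of_nat (Suc n)) * F)
      = (const3 (1 / of_nat (Suc n)) * const3 (of_nat (Suc n))) * (F * h)"
    unfolding f_def by (simp only: ac_simps)
  also have "\<dots> = F * h" by (simp del: of_nat_Suc)
  finally have "der (\<eta> - f *s vars3) F = 0"
    by (simp only: der_vec_diff der_scale euler_identity[OF hom(1)] h diff_self)
  moreover have "homogeneous3 (Suc r) (f * vars3 $ i)" for i
    using homogeneous3_mult[OF f homogeneous3_vars, of i] by simp
  then have "homogeneous_der (Suc r) (\<eta> - f *s vars3)"
    using \<eta> by (simp add: homogeneous_der_def homogeneous3_diff del: vars3_nth)
  ultimately show ?thesis by (auto simp: D0_iff)
qed

text \<open>A row operation on the determinant: the Euler corrections do not affect Saito's
  criterion.\<close>

lemma dot3_cross_shear: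
  "dot3 v (cross (s - f *s v) (t - g *s v)) = dot3 v (cross s t)"
  by (simp add: vec3_simps algebra_simps)

text \<open>Multiplicativity of the determinant, for a block triangular coefficient matrix.\<close>

lemma dot3_cross_frame:
  "dot3 (x *s u + y *s v + z *s w) (cross (a *s v + b *s w) (a' *s v + b' *s w))
    = x * (a * b' - b * a') * dot3 u (cross v w)"
  by (simp add: vec3_simps algebra_simps)

section \<open>Prime divisors and derivatives\<close>

lemma prime_elem_not_dvd_const:
  assumes "prime_elem g" "c \<noteq> 0" shows "\<not> g dvd const3 c"
proof
  assume "g dvd const3 c"
  then have "g dvd const3 c * const3 (1 / c)" by (rule dvd_mult2)
  then show False using assms by (simp add: prime_elem_def)
qed

text \<open>Modulo \<open>g\<close>, the product rule leaves only
  \<open>der \<theta> f * R\<close>.\<close>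

lemma not_dvd_der_factor:
  assumes "prime_elem g" "F = f * R" "g dvd f" "\<not> g dvd R" "\<not> g dvd der \<theta> f"
  shows "\<not> g dvd der \<theta> F"
proof
  assume "g dvd der \<theta> F"
  then have "g dvd der \<theta> f * R + f * der \<theta> R" using assms(2) by (simp add: der_mult)
  then have "g dvd der \<theta> f * R" using assms(3) by (simp add: dvd_add_left_iff)
  then show False using assms by (simp add: prime_elem_dvd_mult_iff)
qed

text \<open>A prime dividing two independent linear forms \<open>U, V\<close> would, by differentiating \<open>U = g a\<close> and
  \<open>V = g b\<close>, first divide \<open>b\<close> and then \<open>1\<close>.\<close>

lemma prime_elem_not_dvd_independent:
  assumes g: "prime_elem g" "g dvd U" "g dvd V"
    and der: "der \<theta> U = 1" "der \<theta> V = 0" "der \<eta> V = 1"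
  shows False
proof -
  have unit: "\<not> g dvd 1" using g(1) by (simp add: prime_elem_def)
  obtain a b where a: "U = g * a" and b: "V = g * b" using g(2,3) unfolding dvd_def by blast
  have "1 = der \<theta> g * a + g * der \<theta> a" using der(1) by (simp add: a der_mult)
  then have "\<not> g dvd der \<theta> g" using unit by (metis dvd_add dvd_mult2 dvd_triv_left)
  moreover have "g dvd der \<theta> g * b"
    using der(2) by (simp add: b der_mult) (metis add_eq_0_iff dvd_minus_iff dvd_triv_left)
  ultimately have "g dvd b" using g(1) by (simp add: prime_elem_dvd_mult_iff)
  then have "g dvd der \<eta> g * b + g * der \<eta> b" by simp
  then show False using der(3) unit by (simp add: b der_mult)
qed

subsection \<open>The arrangement in normal form\<close>

text \<open>As a derivation, this is the directional derivative along \<open>e\<close>.\<close>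

definition const_vec :: "complex ^ 3 \<Rightarrow> S ^ 3" where
  "const_vec e = (\<chi> i. const3 (e $ i))"

lemma dot3_cross_const_vec:
  "dot3 (const_vec u) (cross (const_vec v) (const_vec w)) = const3 (dot3 u (cross v w))"
  by (simp add: vec3_simps const_vec_def)

text \<open>Linear coordinates dual to a basis: the derivations along the basis vectors act as the
  partial derivatives in \<open>X\<close>, \<open>Y\<close>, \<open>Z\<close>, so the normal form
  can be treated inside \<open>S\<close> without a change of variables.\<close>

locale frame =
  fixes X Y Z :: S and e\<^sub>1 e\<^sub>2 e\<^sub>3 :: "complex ^ 3"
  assumes hom: "homogeneous3 1 X" "homogeneous3 1 Y" "homogeneous3 1 Z"
    and dual [simp]:
      "der (const_vec e\<^sub>1) X = 1" "der (const_vec e\<^sub>1) Y = 0" "der (const_vec e\<^sub>1) Z = 0"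
      "der (const_vec e\<^sub>2) X = 0" "der (const_vec e\<^sub>2) Y = 1" "der (const_vec e\<^sub>2) Z = 0"
      "der (const_vec e\<^sub>3) X = 0" "der (const_vec e\<^sub>3) Y = 0" "der (const_vec e\<^sub>3) Z = 1"
    and vars: "vars3 = X *s const_vec e\<^sub>1 + Y *s const_vec e\<^sub>2 + Z *s const_vec e\<^sub>3"
    and det: "dot3 e\<^sub>1 (cross e\<^sub>2 e\<^sub>3) \<noteq> 0"
begin

definition line :: "complex \<Rightarrow> S" where "line s = Z + const3 s * X"

definition conic :: "complex \<Rightarrow> S" where "conic s = Y * Y + X * line s"

lemma hom_line: "homogeneous3 1 (line s)"
  unfolding line_def using hom by (intro homogeneous3_add homogeneous3_const_mult)

lemma hom_conic: "homogeneous3 2 (conic s)"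
  using homogeneous3_add[OF homogeneous3_mult[OF hom(2) hom(2)] homogeneous3_mult[OF hom(1) hom_line[of s]]]
  by (simp add: conic_def numeral_2_eq_2)

lemma der_line [simp]: "der (const_vec e\<^sub>3) (line s) = 1"
  and der_conic [simp]: "der (const_vec e\<^sub>3) (conic s) = X"
  by (simp_all add: line_def conic_def der_add der_mult)

lemma X_nz: "X \<noteq> 0" and Y_nz: "Y \<noteq> 0"
  using dual(1,5) by (metis der_0 zero_neq_one)+

lemma line_nz: "line s \<noteq> 0"
  using der_line by (metis der_0 zero_neq_one)

lemma conic_nz: "conic s \<noteq> 0"
  using der_conic X_nz by (metis der_0)

section \<open>Pairwise coprimality of the components\<close>

context
  fixes g :: S assumes g: "prime_elem g"
begin

lemma not_dvd_X_line: "g dvd X \<Longrightarrow> \<not> g dvd line s"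
proof
  assume "g dvd X" "g dvd line s"
  then have "g dvd line s - const3 s * X" by (intro dvd_diff) auto
  then have "g dvd Z" by (simp add: line_def)
  then show False using prime_elem_not_dvd_independent[OF g \<open>g dvd X\<close> _ dual(1) dual(3) dual(9)] by blast
qed

lemma not_dvd_X_conic: "g dvd X \<Longrightarrow> \<not> g dvd conic s"
proof
  assume "g dvd X" "g dvd conic s"
  then have "g dvd Y" using g by (simp add: conic_def dvd_add_left_iff prime_elem_dvd_mult_iff)
  then show False using prime_elem_not_dvd_independent[OF g \<open>g dvd X\<close> _ dual(1) dual(2) dual(5)] by blast
qed

lemma not_dvd_two_lines: "g dvd line s \<Longrightarrow> s \<noteq> t \<Longrightarrow> \<not> g dvd line t"
proof
  assume *: "g dvd line s" "s \<noteq> t" "g dvd line t"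
  have "const3 (s - t) * X = line s - line t"
    unfolding line_def const3_simps(5)[symmetric] by (simp add: algebra_simps del: const3_simps)
  then have "g dvd const3 (s - t) * X" using * by (simp only: dvd_diff)
  then have "g dvd X" using g prime_elem_not_dvd_const[of g "s - t"] *
    by (simp add: prime_elem_dvd_mult_iff del: const3_simps)
  then show False using not_dvd_X_line * by blast
qed

text \<open>Two of these conics differ by a nonzero multiple of \<open>X * X\<close>, so a common
  prime would divide \<open>X\<close>.\<close>

lemma not_dvd_two_conics: "g dvd conic s \<Longrightarrow> s \<noteq> t \<Longrightarrow> \<not> g dvd conic t"
proof
  assume *: "g dvd conic s" "s \<noteq> t" "g dvd conic t"
  have "const3 (s - t) * (X * X) = conic s - conic t"
    unfolding line_def conic_def const3_simps(5)[symmetric] by (simp add: algebra_simps del: const3_simps)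
  then have "g dvd const3 (s - t) * (X * X)" using * by (simp only: dvd_diff)
  then have "g dvd X" using g prime_elem_not_dvd_const[of g "s - t"] *
    by (simp add: prime_elem_dvd_mult_iff del: const3_simps)
  then show False using not_dvd_X_conic * by blast
qed

text \<open>On the line \<open>line s = 0\<close> the equation of \<open>conic t\<close> becomes \<open>Y\<^sup>2 = (s - t) X\<^sup>2\<close>, which splits
  into two linear factors.\<close>

lemma not_dvd_line_conic: "g dvd line s \<Longrightarrow> \<not> g dvd conic t"
proof
  assume *: "g dvd line s" "g dvd conic t"
  define r where "r = csqrt (s - t)"
  have r: "const3 r * const3 r = const3 s - const3 t"
  proof -
    have "r * r = s - t" by (simp add: r_def flip: power2_eq_square)
    then show ?thesis by simp
  qed
  have "(Y + const3 r * X) * (Y - const3 r * X) = Y * Y - (const3 r * const3 r) * X * X"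
    by (simp add: algebra_simps del: const3_simps)
  also have "\<dots> = conic t - X * line s"
    unfolding r conic_def line_def by (simp add: algebra_simps del: const3_simps)
  finally have "g dvd (Y + const3 r * X) * (Y - const3 r * X)" using * by simp
  \<comment> \<open>The derivative along \<open>e\<^sub>2\<close> sends the first form to 1 and
    kills the line, and the one along \<open>e\<^sub>3\<close> sends the line to 1. General
    \<open>q\<close> covers both factors.\<close>
  moreover have "\<not> g dvd Y + const3 q * X" for q
  proof
    assume "g dvd Y + const3 q * X"
    then show False
      using prime_elem_not_dvd_independent[OF g _ *(1), of "Y + const3 q * X" "const_vec e\<^sub>2" "const_vec e\<^sub>3"]
      by (simp add: der_add der_mult line_def)
  qed
  from this[of r] this[of "- r"] have "\<not> g dvd Y + const3 r * X" "\<not> g dvd Y - const3 r * X"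
    by (simp_all flip: const3_simps(6))
  ultimately show False using g by (simp add: prime_elem_dvd_mult_iff)
qed

end

end

text \<open>\<open>J\<close> is the number \<open>j - 1\<close> of added tangents, and
  \<open>C\<close> absorbs the scalars by which the given equations differ from the normal
  forms.\<close>

locale arrangement = frame +
  fixes m J :: nat and t :: "nat \<Rightarrow> complex" and C :: complex
  assumes J: "1 \<le> J" "J \<le> m" and inj: "inj_on t {1..m}" and C: "C \<noteq> 0"
begin

definition F :: S where
  "F = const3 C * X * (\<Prod>k=1..m. conic (t k)) * (\<Prod>k=1..J. line (t k))"

lemma F_nz: "F \<noteq> 0"
  using C X_nz line_nz conic_nz by (simp add: F_def)

lemma hom_F: "homogeneous3 (Suc (2 * m + J)) F"
proof -
  have "homogeneous3 (1 + card {1..m} * 2 + card {1..J} * 1) F"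
    unfolding F_def
    by (intro homogeneous3_mult homogeneous3_const_mult homogeneous3_prod hom hom_conic hom_line) auto
  then show ?thesis by (simp add: algebra_simps)
qed

section \<open>Reducedness, from the prime divisors of \<open>F\<close>\<close>

lemma prime_elem_dvd_prod:
  fixes g :: "'a::comm_semiring_1"
  assumes "prime_elem g" "g dvd (\<Prod>k\<in>K. f k)"
  shows "\<exists>k\<in>K. g dvd f k"
  using assms(2)
proof (induction K rule: infinite_finite_induct)
  case (insert k K)
  then show ?case using assms(1) by (auto simp: prime_elem_dvd_mult_iff)
qed (use assms(1) in \<open>auto simp: prime_elem_def\<close>)

text \<open>By coprimality \<open>g\<close> divides only one factor, and by the product rule the
  derivative of that factor decides: it is 1 for \<open>X\<close> along \<open>e\<^sub>1\<close>,
  and along \<open>e\<^sub>3\<close> it is 1 for a line and \<open>X\<close> for a conic.\<close>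

lemma prime_dvd_F:
  assumes g: "prime_elem g" and "g dvd F"
  shows "\<exists>e. \<not> g dvd der (const_vec e) F"
proof -
  have notC: "\<not> g dvd const3 C" using g C by (rule prime_elem_not_dvd_const)
  consider "g dvd X" | k where "k \<in> {1..m}" "g dvd conic (t k)" | k where "k \<in> {1..J}" "g dvd line (t k)"
    using assms notC by (auto simp: F_def prime_elem_dvd_mult_iff dest!: prime_elem_dvd_prod[OF g])
  then show ?thesis
  proof cases
    case 1
    have "\<not> g dvd const3 C * (\<Prod>k=1..m. conic (t k)) * (\<Prod>k=1..J. line (t k))"
      using notC not_dvd_X_line[OF g 1] not_dvd_X_conic[OF g 1]
      by (auto simp: prime_elem_dvd_mult_iff[OF g] dest!: prime_elem_dvd_prod[OF g])
    then have "\<not> g dvd der (const_vec e\<^sub>1) F"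
      using g 1 by (intro not_dvd_der_factor[of g F X]) (auto simp: F_def prime_elem_def)
    then show ?thesis ..
  next
    case 2
    have X: "\<not> g dvd X" using not_dvd_X_conic[OF g, of "t k"] 2(2) by auto
    have "\<not> g dvd (\<Prod>k\<in>{1..m}-{k}. conic (t k))"
    proof (rule notI, drule prime_elem_dvd_prod[OF g], elim bexE)
      fix l assume "l \<in> {1..m} - {k}" "g dvd conic (t l)"
      then show False using not_dvd_two_conics[OF g 2(2), of "t l"] inj_on_eq_iff[OF inj, of k l] 2(1) by auto
    qed
    then have "\<not> g dvd const3 C * X * (\<Prod>k\<in>{1..m}-{k}. conic (t k)) * (\<Prod>k=1..J. line (t k))"
      using notC X not_dvd_line_conic[OF g, of _ "t k"] 2(2)
      by (auto simp: prime_elem_dvd_mult_iff[OF g] dest!: prime_elem_dvd_prod[OF g])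
    moreover have "F = conic (t k) * (const3 C * X * (\<Prod>k\<in>{1..m}-{k}. conic (t k)) * (\<Prod>k=1..J. line (t k)))"
      unfolding F_def using 2(1) by (subst prod.remove[of _ k]) (simp_all add: ac_simps)
    ultimately have "\<not> g dvd der (const_vec e\<^sub>3) F"
      using g 2(2) X by (intro not_dvd_der_factor[of g F "conic (t k)"]) auto
    then show ?thesis ..
  next
    case 3
    have X: "\<not> g dvd X" using not_dvd_X_line[OF g, of "t k"] 3(2) by auto
    have "\<not> g dvd (\<Prod>k\<in>{1..J}-{k}. line (t k))"
    proof (rule notI, drule prime_elem_dvd_prod[OF g], elim bexE)
      fix l assume "l \<in> {1..J} - {k}" "g dvd line (t l)"
      then show False using not_dvd_two_lines[OF g 3(2), of "t l"] inj_on_eq_iff[OF inj, of k l] 3(1) J by auto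
    qed
    then have "\<not> g dvd const3 C * X * (\<Prod>k=1..m. conic (t k)) * (\<Prod>k\<in>{1..J}-{k}. line (t k))"
      using notC X not_dvd_line_conic[OF g 3(2)]
      by (auto simp: prime_elem_dvd_mult_iff[OF g] dest!: prime_elem_dvd_prod[OF g])
    moreover have "F = line (t k) * (const3 C * X * (\<Prod>k=1..m. conic (t k)) * (\<Prod>k\<in>{1..J}-{k}. line (t k)))"
      unfolding F_def using 3(1) prod.remove[of "{1..J}" k "\<lambda>k. line (t k)"] by (simp add: ac_simps)
    ultimately have "\<not> g dvd der (const_vec e\<^sub>3) F"
      using g 3(2) X by (intro not_dvd_der_factor[of g F "line (t k)"]) (auto simp: prime_elem_def)
    then show ?thesis ..
  qed
qed

text \<open>By Euler's identity a prime dividing all partial derivatives divides \<open>F\<close> as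
  well.\<close>

lemma primitive: "gradient_primitive F"
  unfolding gradient_primitive_def
proof (intro allI impI, rule ccontr)
  fix g assume g: "prime_elem g" and "\<not> (\<exists>i. \<not> g dvd grad3 F $ i)"
  then have dvd: "g dvd der \<theta> F" for \<theta> unfolding der_def by (intro dvd_sum) simp
  have "g dvd const3 (of_nat (Suc (2 * m + J))) * F"
    using dvd[of vars3] euler_identity[OF hom_F] by simp
  then have "g dvd F"
    using g prime_elem_not_dvd_const[OF g, of "of_nat (Suc (2 * m + J))"]
    by (simp add: prime_elem_dvd_mult_iff del: of_nat_Suc)
  then show False using prime_dvd_F g dvd by blast
qed

text \<open>A repeated prime factor would divide every derivative of \<open>F\<close>.\<close>

lemma squarefree: "squarefree F"
  unfolding squarefree_def
proof (intro allI impI, rule ccontr)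
  fix x assume x: "x ^ 2 dvd F" "\<not> is_unit x"
  have "x \<noteq> 0" using x F_nz by auto
  then obtain g where g: "g dvd x" "prime g" using x(2) prime_divisor_exists by blast
  then have "g ^ 2 dvd F" using x(1) dvd_power_same dvd_trans by blast
  then obtain h where h: "F = g * (g * h)" unfolding dvd_def power2_eq_square mult.assoc by blast
  then have "g dvd der \<theta> F" for \<theta> by (simp add: der_mult)
  then show False using prime_dvd_F[of g] g h by auto
qed

text \<open>Modulo \<open>Y\<close>, each conic is \<open>X\<close> times its line. The cofactor of
  \<open>Y\<close> supplies the coefficient \<open>a\<close> of the second derivation.\<close>

lemma prod_conic_expand:
  assumes "finite K"
  shows "\<exists>a. (\<Prod>k\<in>K. conic (t k)) = Y * a + (\<Prod>k\<in>K. X * line (t k))"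
  using assms
proof induction
  case (insert k K)
  then obtain a where a: "(\<Prod>k\<in>K. conic (t k)) = Y * a + (\<Prod>k\<in>K. X * line (t k))" by blast
  have "(\<Prod>k\<in>insert k K. conic (t k)) =
      Y * (Y * (\<Prod>k\<in>K. conic (t k)) + X * line (t k) * a) + (\<Prod>k\<in>insert k K. X * line (t k))"
    using insert by (simp add: a conic_def[of "t k"] algebra_simps)
  then show ?case by blast
qed (auto intro: exI[of _ 0])

lemma basis: "\<exists>\<theta>\<^sub>1 \<theta>\<^sub>2. saito F \<theta>\<^sub>1 \<theta>\<^sub>2 (2 * m + J) (Suc J) (2 * m - 1) (dot3 e\<^sub>1 (cross e\<^sub>2 e\<^sub>3) / C)"
proof -
  have m: "2 * m = Suc (2 * m - 1)" "m = Suc (m - 1)" using J by auto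
  \<comment> \<open>The degree is positive because \<open>1 \<le> m\<close>;
    \<open>euler_correction\<close> expects it as a successor.\<close>
  have m2: "Suc (2 * m - 2) = 2 * m - 1" using J by auto
  define W where "W = (\<Prod>k=1..J. line (t k))"
  define P where "P = (\<Prod>k=1..m. conic (t k))"
  define b where "b = X ^ (m - 1) * (\<Prod>k=1..m. line (t k))"
  obtain a\<^sub>0 where a\<^sub>0: "P = Y * a\<^sub>0 + (\<Prod>k=1..m. X * line (t k))"
    unfolding P_def using prod_conic_expand[of "{1..m}"] by auto
  \<comment> \<open>The factor 1/2 compensates the 2 in the derivative of
    \<open>Y * Y\<close>.\<close>
  define a where "a = const3 (1 / 2) * a\<^sub>0"
  have Xb: "X * b = (\<Prod>k=1..m. X * line (t k))"
    using m(2) by (simp add: b_def prod.distrib mult.assoc[symmetric] flip: power_Suc)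
  have "const3 2 * Y * a = (const3 2 * const3 (1 / 2)) * (Y * a\<^sub>0)"
    unfolding a_def by (simp only: ac_simps)
  then have ab: "const3 2 * Y * a + X * b = P" by (simp add: Xb a\<^sub>0)
  have hom_W: "homogeneous3 J W"
    using homogeneous3_prod[of "{1..J}" 1, OF _ hom_line] by (simp add: W_def)
  have hom_P: "homogeneous3 (2 * m) P"
    using homogeneous3_prod[of "{1..m}" 2, OF _ hom_conic] by (simp add: P_def mult.commute)
  have "homogeneous3 ((m - 1) * 1 + card {1..m} * 1) b"
    unfolding b_def by (intro homogeneous3_mult homogeneous3_power homogeneous3_prod hom hom_line) auto
  then have hom_b: "homogeneous3 (2 * m - 1) b" using m(2) by (simp add: mult_2)
  have 2: "homogeneous3 1 (const3 2 * Y)" using homogeneous3_const_mult hom(2) by blast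
  \<comment> \<open>\<open>2 * Y * a\<close> is the form \<open>P - X * b\<close>; cancelling
    \<open>2 * Y\<close> shows that \<open>a\<close> is a form.\<close>
  have "homogeneous3 (1 + (2 * m - 1)) (X * b)" using homogeneous3_mult[OF hom(1) hom_b] .
  then have "homogeneous3 (1 + (2 * m - 1)) (const3 2 * Y * a)"
    using homogeneous3_diff[OF hom_P, of "X * b"] m(1) by (simp flip: ab)
  then have hom_a: "homogeneous3 (2 * m - 1) a"
    using homogeneous3_cancel[OF 2] Y_nz by simp

  \<comment> \<open>Without \<open>W\<close> this derivation would send every line to
    \<open>- 2 * Y\<close>; the factor makes the image divisible by the lines in
    \<open>F\<close>.\<close>
  define \<eta>\<^sub>1 where "\<eta>\<^sub>1 = (W * X) *s const_vec e\<^sub>2 + (- const3 2 * W * Y) *s const_vec e\<^sub>3"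
  define \<eta>\<^sub>2 where "\<eta>\<^sub>2 = a *s const_vec e\<^sub>2 + b *s const_vec e\<^sub>3"
  have const: "homogeneous3 0 (const_vec e $ i)" for e i by (simp add: const_vec_def)
  have hom_vec: "homogeneous_der r (f *s const_vec e + g *s const_vec e')"
    if "homogeneous3 r f" "homogeneous3 r g" for f g r e e'
    using homogeneous3_add[OF homogeneous3_mult[OF that(1) const] homogeneous3_mult[OF that(2) const]]
    by (simp add: homogeneous_der_def)
  have WX: "homogeneous3 (Suc J) (W * X)" and WY: "homogeneous3 (Suc J) (W * Y)"
    using homogeneous3_mult[OF hom_W hom(1)] homogeneous3_mult[OF hom_W hom(2)] by simp_all
  have hom1: "homogeneous_der (Suc J) \<eta>\<^sub>1"
    unfolding \<eta>\<^sub>1_def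
  proof (rule hom_vec[OF WX])
    show "homogeneous3 (Suc J) (- const3 2 * W * Y)"
      unfolding const3_simps mult.assoc by (rule homogeneous3_const_mult[OF WY])
  qed
  have hom2: "homogeneous_der (Suc (2 * m - 2)) \<eta>\<^sub>2"
    unfolding \<eta>\<^sub>2_def m2 using hom_vec[OF hom_a hom_b] .

  have "const3 2 = 2" by (simp add: const3_def numeral_poly)
  then have [simp]: "const3 (- 2) = - 2" using const3_simps(6)[of 2] by simp
  have der2_conic: "der \<eta>\<^sub>2 (conic s) = P" for s
    unfolding ab[symmetric]
    by (simp add: \<eta>\<^sub>2_def conic_def line_def der_vec_add der_vec_diff der_scale der_add der_mult)
      (simp add: \<open>const3 2 = 2\<close> algebra_simps)
  have der2_line: "der \<eta>\<^sub>2 (line s) = b" for s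
    by (simp add: \<eta>\<^sub>2_def line_def der_vec_add der_vec_diff der_scale der_add der_mult)
  have der1_conic: "der \<eta>\<^sub>1 (conic s) = 0" for s
    by (simp add: \<eta>\<^sub>1_def conic_def line_def der_vec_add der_vec_diff der_scale der_add der_mult algebra_simps)
  have der1_line: "der \<eta>\<^sub>1 (line s) = W * (- const3 2 * Y)" for s
    by (simp add: \<eta>\<^sub>1_def line_def der_vec_add der_vec_diff der_scale der_add der_mult)
  have der_X: "der \<eta>\<^sub>1 X = 0" "der \<eta>\<^sub>2 X = 0"
    by (simp_all add: \<eta>\<^sub>1_def \<eta>\<^sub>2_def der_vec_add der_vec_diff der_scale)

  have dvd1: "F dvd der \<eta>\<^sub>1 F"
    unfolding F_def
  proof (intro dvd_der_mult dvd_der_prod)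
    fix k assume "k \<in> {1..J}"
    then have "line (t k) dvd W" unfolding W_def by (intro dvd_prodI) auto
    then show "line (t k) dvd der \<eta>\<^sub>1 (line (t k))" unfolding der1_line by (rule dvd_mult2)
  qed (simp_all add: der1_conic der_X)
  have dvd2: "F dvd der \<eta>\<^sub>2 F"
    unfolding F_def
  proof (intro dvd_der_mult dvd_der_prod)
    fix k assume "k \<in> {1..J}"
    \<comment> \<open>As \<open>J \<le> m\<close>, the lines in \<open>F\<close> are among the
      \<open>m\<close> lines whose product divides \<open>b\<close>.\<close>
    then have "line (t k) dvd (\<Prod>k=1..m. line (t k))" using J by (intro dvd_prodI) auto
    then show "line (t k) dvd der \<eta>\<^sub>2 (line (t k))" unfolding der2_line b_def by (rule dvd_mult)
  next
    fix k assume "k \<in> {1..m}"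
    then show "conic (t k) dvd der \<eta>\<^sub>2 (conic (t k))" unfolding der2_conic P_def by (intro dvd_prodI) auto
  qed (simp_all add: der_X)

  obtain f\<^sub>1 where f\<^sub>1: "\<eta>\<^sub>1 - f\<^sub>1 *s vars3 \<in> D0 F" "homogeneous_der (Suc J) (\<eta>\<^sub>1 - f\<^sub>1 *s vars3)"
    using euler_correction[OF hom_F F_nz hom1 dvd1] by blast
  obtain f\<^sub>2 where f\<^sub>2: "\<eta>\<^sub>2 - f\<^sub>2 *s vars3 \<in> D0 F"
      "homogeneous_der (2 * m - 1) (\<eta>\<^sub>2 - f\<^sub>2 *s vars3)"
    using euler_correction[OF hom_F F_nz hom2 dvd2] unfolding m2 by blast
  have "dot3 vars3 (cross (\<eta>\<^sub>1 - f\<^sub>1 *s vars3) (\<eta>\<^sub>2 - f\<^sub>2 *s vars3)) = dot3 vars3 (cross \<eta>\<^sub>1 \<eta>\<^sub>2)"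
    by (rule dot3_cross_shear)
  also have "\<dots> = X * (W * X * b - (- const3 2 * W * Y) * a) * const3 (dot3 e\<^sub>1 (cross e\<^sub>2 e\<^sub>3))"
    unfolding \<eta>\<^sub>1_def \<eta>\<^sub>2_def vars dot3_cross_frame dot3_cross_const_vec ..
  also have "W * X * b - (- const3 2 * W * Y) * a = W * P"
    unfolding ab[symmetric] by (simp add: algebra_simps del: const3_simps)
  \<comment> \<open>The equation \<open>F\<close> contains the scalar \<open>C\<close>, hence the
    division by \<open>C\<close> in the constant.\<close>
  also have "X * (W * P) * const3 (dot3 e\<^sub>1 (cross e\<^sub>2 e\<^sub>3)) =
      X * (W * P) * (const3 (dot3 e\<^sub>1 (cross e\<^sub>2 e\<^sub>3) / C) * const3 C)" using C by simp
  also have "\<dots> = const3 (dot3 e\<^sub>1 (cross e\<^sub>2 e\<^sub>3) / C) * F"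
    unfolding F_def P_def W_def by (simp only: ac_simps)
  finally have "saito F (\<eta>\<^sub>1 - f\<^sub>1 *s vars3) (\<eta>\<^sub>2 - f\<^sub>2 *s vars3) (2 * m + J) (Suc J) (2 * m - 1)
      (dot3 e\<^sub>1 (cross e\<^sub>2 e\<^sub>3) / C)"
    using f\<^sub>1 f\<^sub>2 F_nz hom_F primitive det C m by unfold_locales auto
  then show ?thesis by blast
qed

lemma free_curve: "free_curve F"
proof -
  obtain \<theta>\<^sub>1 \<theta>\<^sub>2 where "saito F \<theta>\<^sub>1 \<theta>\<^sub>2 (2 * m + J) (Suc J) (2 * m - 1) (dot3 e\<^sub>1 (cross e\<^sub>2 e\<^sub>3) / C)"
    using basis by blast
  then have "free_graded (D0 F)" by (rule saito.free)
  then show ?thesis using squarefree F_nz hom_F by (auto simp: free_curve_def plane_curve_def)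
qed

text \<open>With \<open>J \<le> m\<close> and \<open>2 \<le> m\<close>, the first degree is the
  smaller one: \<open>Suc J \<le> m + 1 \<le> 2 * m - 1\<close>.\<close>

lemma mdr_F:
  assumes "m \<ge> 2"
  shows "mdr F = Suc J"
proof -
  obtain \<theta>\<^sub>1 \<theta>\<^sub>2 where "saito F \<theta>\<^sub>1 \<theta>\<^sub>2 (2 * m + J) (Suc J) (2 * m - 1) (dot3 e\<^sub>1 (cross e\<^sub>2 e\<^sub>3) / C)"
    using basis by blast
  then show ?thesis by (rule saito.mdr_eq) (use J assms in linarith)
qed

end

subsection \<open>Linear and quadratic forms\<close>

definition lin :: "complex ^ 3 \<Rightarrow> S" where
  "lin u = (\<Sum>i\<in>UNIV. const3 (u $ i) * vars3 $ i)"

text \<open>For a quadratic form, \<open>dot3 (grad_at G u) v\<close> is its polar bilinear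
  form.\<close>

definition grad_at :: "S \<Rightarrow> complex ^ 3 \<Rightarrow> complex ^ 3" where
  "grad_at G v = (\<chi> i. eval3 (grad3 G $ i) v)"

lemma eval3_lin [simp]: "eval3 (lin u) v = dot3 u v"
  by (simp add: lin_def sum_3 dot3_def del: vars3_nth)

lemma lin_add: "lin (u + v) = lin u + lin v"
  and lin_scale: "lin (c *s u) = const3 c * lin u"
  by (rule eval3_eqI; simp add: dot3_def algebra_simps)+

lemma grad3_lin [simp]: "grad3 (lin u) $ i = const3 (u $ i)"
proof -
  have "\<forall>i. grad3 (lin u) $ i = const3 (u $ i)"
    by (simp add: forall_3 lin_def sum_3 del: vars3_nth)
  then show ?thesis by blast
qed

lemma homogeneous3_lin: "homogeneous3 1 (lin u)"
  unfolding lin_def by (intro homogeneous3_sum homogeneous3_const_mult homogeneous3_vars)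

lemma der_const_vec_lin: "der (const_vec e) (lin u) = const3 (dot3 e u)"
  by (simp add: der_def sum_3 const_vec_def dot3_def)

lemma tangent_at_iff:
  "tangent_at L G a \<longleftrightarrow>
    a \<in> zero_locus G \<and> plane_curve 1 L \<and> (\<exists>c. c \<noteq> 0 \<and> L = lin (c *s grad_at G a))"
  by (simp add: tangent_at_def same_curve_def lin_scale) (simp add: lin_def grad_at_def)

text \<open>Reduces the polarization identities below to algebra in six coefficients.\<close>

lemma quadratic_form_coeffs:
  assumes "homogeneous3 2 G"
  obtains a b c d e f where "G = const3 a * (vars3 $ 1 * vars3 $ 1) + const3 b * (vars3 $ 2 * vars3 $ 2)
    + const3 c * (vars3 $ 3 * vars3 $ 3) + const3 d * (vars3 $ 1 * vars3 $ 2)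
    + const3 e * (vars3 $ 1 * vars3 $ 3) + const3 f * (vars3 $ 2 * vars3 $ 3)"
proof -
  define g where "g k j i = coeff (coeff (coeff G k) j) i" for k j i
  have z: "g k j i = 0" if "i + j + k \<noteq> 2" for k j i
    using assms that by (auto simp: homogeneous3_def g_def)
  have three: "p = [:coeff p 0, coeff p 1, coeff p 2:]" if "\<And>k. k > 2 \<Longrightarrow> coeff p k = 0"
    for p :: "'b::zero poly"
    by (rule poly_eqI) (use that in \<open>auto simp: coeff_pCons numeral_2_eq_2 split: nat.splits\<close>)
  have row: "coeff (coeff G k) j = [:g k j 0, g k j 1, g k j 2:]" for k j
    unfolding g_def by (rule three) (use z in \<open>auto simp: g_def\<close>)
  have slice: "coeff G k = [:coeff (coeff G k) 0, coeff (coeff G k) 1, coeff (coeff G k) 2:]" for k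
    by (rule three, rule poly_eqI) (use z in \<open>auto simp: g_def\<close>)
  have "G = [:coeff G 0, coeff G 1, coeff G 2:]"
    by (rule three, intro poly_eqI) (use z in \<open>auto simp: g_def\<close>)
  also have "\<dots> = [: [: [:0, 0, g 0 0 2:], [:0, g 0 1 1:], [:g 0 2 0:] :],
      [: [:0, g 1 0 1:], [:g 1 1 0:] :], [:[:g 2 0 0:]:] :]"
    unfolding slice[unfolded row] by (simp add: z)
  also have "\<dots> = const3 (g 0 0 2) * (vars3 $ 1 * vars3 $ 1) + const3 (g 0 2 0) * (vars3 $ 2 * vars3 $ 2)
    + const3 (g 2 0 0) * (vars3 $ 3 * vars3 $ 3) + const3 (g 0 1 1) * (vars3 $ 1 * vars3 $ 2)
    + const3 (g 1 0 1) * (vars3 $ 1 * vars3 $ 3) + const3 (g 1 1 0) * (vars3 $ 2 * vars3 $ 3)"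
    by (simp add: const3_def)
  finally show ?thesis by (rule that)
qed

lemma grad_at_symmetric:
  assumes "homogeneous3 2 G"
  shows "dot3 (grad_at G u) v = dot3 (grad_at G v) u"
proof -
  show ?thesis
    by (rule quadratic_form_coeffs[OF assms])
      (simp add: grad_at_def dot3_def algebra_simps del: vars3_nth)
qed

lemma grad_at_diagonal:
  assumes "homogeneous3 2 G"
  shows "dot3 (grad_at G u) u = 2 * eval3 G u"
  by (rule quadratic_form_coeffs[OF assms])
    (simp add: grad_at_def dot3_def algebra_simps del: vars3_nth)

lemma eval3_quadratic:
  assumes "homogeneous3 2 G"
  shows "eval3 G (x *s u + y *s v + z *s w) =
    x * x * eval3 G u + y * y * eval3 G v + z * z * eval3 G w + x * y * dot3 (grad_at G u) v
    + x * z * dot3 (grad_at G u) w + y * z * dot3 (grad_at G v) w"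
  by (rule quadratic_form_coeffs[OF assms])
    (simp add: grad_at_def dot3_def algebra_simps del: vars3_nth)

subsection \<open>Coordinates with respect to a basis\<close>

lemma cross_zero_same_point:
  assumes "cross u v = 0" "u \<noteq> 0" "v \<noteq> (0 :: complex ^ 3)"
  shows "same_point u v"
proof -
  obtain k where k: "v $ k \<noteq> 0" using assms(3) by (auto simp: vec_eq_iff)
  have *: "\<forall>i k. u $ k * v $ i = u $ i * v $ k"
    using assms(1) by (auto simp: vec3_simps algebra_simps)
  have "u $ i = u $ k / v $ k * v $ i" for i
    using *[rule_format, of k i] k by (metis nonzero_mult_div_cancel_right times_divide_eq_left)
  then obtain c where "u = c *s v" unfolding vec_eq_iff vector_smult_component by blast
  then show ?thesis using assms(2) by (auto simp: same_point_def)
qed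

lemma orthogonal_to_two:
  fixes u p q :: "complex ^ 3"
  assumes "dot3 u p = 0" "dot3 u q = 0" "u \<noteq> 0" "cross q p \<noteq> 0"
  shows "same_point u (cross q p)"
proof -
  have "cross u (cross q p) = dot3 u p *s q - dot3 u q *s p"
    by (simp add: vec3_simps algebra_simps)
  then show ?thesis using assms cross_zero_same_point by simp
qed

lemma orthogonal_to_basis:
  fixes g u v w :: "complex ^ 3"
  assumes "dot3 u (cross v w) \<noteq> 0" "dot3 g u = 0" "dot3 g v = 0" "dot3 g w = 0"
  shows "g = 0"
proof -
  have "dot3 u (cross v w) *s g = dot3 g u *s cross v w + dot3 g v *s cross w u + dot3 g w *s cross u v"
    by (simp add: vec3_simps algebra_simps)
  then show ?thesis using assms by simp
qed

text \<open>The scaled cross products are the dual basis of \<open>u\<close>, \<open>v\<close>,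
  \<open>w\<close>.\<close>

lemma cramer3:
  fixes u v w x :: "complex ^ 3"
  assumes "dot3 u (cross v w) = d" "d \<noteq> 0"
  shows "x = dot3 ((1 / d) *s cross v w) x *s u + dot3 ((1 / d) *s cross w u) x *s v
    + dot3 ((1 / d) *s cross u v) x *s w"
proof -
  have "d *s x = dot3 (cross v w) x *s u + dot3 (cross w u) x *s v + dot3 (cross u v) x *s w"
    by (simp add: assms(1)[symmetric] vec3_simps algebra_simps)
  then have "(1 / d) *s (d *s x) = (1 / d) *s (dot3 (cross v w) x *s u + dot3 (cross w u) x *s v + dot3 (cross u v) x *s w)"
    by simp
  then have "x = (1 / d) *s (dot3 (cross v w) x *s u + dot3 (cross w u) x *s v + dot3 (cross u v) x *s w)"
    using assms(2) by (simp add: vec_eq_iff)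
  also have "\<dots> = dot3 ((1 / d) *s cross v w) x *s u + dot3 ((1 / d) *s cross w u) x *s v
    + dot3 ((1 / d) *s cross u v) x *s w"
    by (simp add: vec_eq_iff dot3_def algebra_simps add_divide_distrib)
  finally show ?thesis .
qed

lemma frame_of_basis:
  assumes d: "dot3 u (cross v w) = d" "d \<noteq> 0"
  shows "frame (lin ((1 / d) *s cross v w)) (lin ((1 / d) *s cross w u)) (lin ((1 / d) *s cross u v)) u v w"
proof
  let ?a = "(1 / d) *s cross v w" and ?b = "(1 / d) *s cross w u" and ?c = "(1 / d) *s cross u v"
  have scale: "dot3 x ((1 / d) *s y) = dot3 x y / d" for x y
    by (simp add: dot3_def add_divide_distrib)
  have "dot3 v (cross w u) = d" "dot3 w (cross u v) = d"
    unfolding d(1)[symmetric] by (simp_all add: vec3_simps algebra_simps)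
  moreover have "dot3 x (cross x y) = 0" "dot3 y (cross x y) = 0" for x y :: "complex ^ 3"
    by (simp_all add: vec3_simps algebra_simps)
  ultimately show
    "der (const_vec u) (lin ?a) = 1" "der (const_vec u) (lin ?b) = 0" "der (const_vec u) (lin ?c) = 0"
    "der (const_vec v) (lin ?a) = 0" "der (const_vec v) (lin ?b) = 1" "der (const_vec v) (lin ?c) = 0"
    "der (const_vec w) (lin ?a) = 0" "der (const_vec w) (lin ?b) = 0" "der (const_vec w) (lin ?c) = 1"
    using d by (simp_all add: der_const_vec_lin scale)
  show "vars3 = lin ?a *s const_vec u + lin ?b *s const_vec v + lin ?c *s const_vec w"
    unfolding vec_eq_iff
  proof (intro allI eval3_eqI)
    fix i x
    show "eval3 (vars3 $ i) x =
        eval3 ((lin ?a *s const_vec u + lin ?b *s const_vec v + lin ?c *s const_vec w) $ i) x"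
      using arg_cong[OF cramer3[OF d, of x], of "\<lambda>y. y $ i"]
      by (simp add: const_vec_def del: vars3_nth)
  qed
  show "dot3 u (cross v w) \<noteq> 0" using d by simp
qed (rule homogeneous3_lin)+

subsection \<open>Normal form of a hyperosculating pencil\<close>

text \<open>By the fundamental theorem of algebra a polynomial without roots is constant.\<close>

lemma quadratic_no_root:
  fixes a b c :: complex
  assumes "\<And>y. a * (y * y) + b * y + c \<noteq> 0"
  shows "a = 0 \<and> b = 0"
proof -
  have "poly [:c, b, a:] y \<noteq> 0" for y using assms[of y] by (simp add: algebra_simps)
  then have "constant (poly [:c, b, a:])" using fundamental_theorem_of_algebra by blast
  then have "degree [:c, b, a:] = 0" by (simp add: constant_degree)
  then show ?thesis by (simp split: if_splits)
qed

text \<open>Two members of a pencil that are different curves span it.\<close>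

lemma pencil_base_point:
  assumes P: "hyperosculating_pencil \<P> p" and G: "G \<in> \<P>" and H: "H \<in> \<P>"
    and distinct: "\<not> same_curve G H" and v: "v \<in> zero_locus G" "v \<in> zero_locus H"
  shows "same_point v p"
proof -
  obtain A B where pencil: "\<P> = {const3 \<alpha> * A + const3 \<beta> * B |\<alpha> \<beta>. (\<alpha>, \<beta>) \<noteq> (0, 0)}"
    using P unfolding hyperosculating_pencil_def conic_pencil_def by blast
  obtain a b where ab: "G = const3 a * A + const3 b * B" "(a, b) \<noteq> (0, 0)" using G pencil by blast
  obtain c d where cd: "H = const3 c * A + const3 d * B" "(c, d) \<noteq> (0, 0)" using H pencil by blast
  define A' B' where "A' = eval3 A v" and "B' = eval3 B v"
  have eq: "a * A' + b * B' = 0" "c * A' + d * B' = 0"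
    using v by (simp_all add: zero_locus_def ab(1) cd(1) A'_def B'_def)
  \<comment> \<open>A vanishing determinant would make the two nonzero coefficient pairs
    proportional, and \<open>G\<close> and \<open>H\<close> the same curve.\<close>
  have "a * d - b * c \<noteq> 0"
  proof
    assume det: "a * d - b * c = 0"
    obtain k where "k \<noteq> 0" "a = k * c" "b = k * d"
    proof (cases "c = 0")
      case True
      then have "d \<noteq> 0" "a = 0" "b \<noteq> 0" using det ab(2) cd(2) by auto
      then show ?thesis using that[of "b / d"] True by simp
    next
      case False
      then have "b = a / c * d" using det by (simp add: field_simps)
      moreover have "a \<noteq> 0" using calculation ab(2) by auto
      ultimately show ?thesis using that[of "a / c"] False by simp
    qed
    then have "G = const3 k * H"
      by (simp add: ab(1) cd(1) algebra_simps flip: const3_simps(3))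
    then show False using distinct \<open>k \<noteq> 0\<close> by (auto simp: same_curve_def)
  qed
  \<comment> \<open>By Cramer's rule both generators vanish at \<open>v\<close>, and with them the
    whole pencil.\<close>
  moreover have "(a * d - b * c) * A' = d * (a * A' + b * B') - b * (c * A' + d * B')"
    "(a * d - b * c) * B' = a * (c * A' + d * B') - c * (a * A' + b * B')"
    by (simp_all add: algebra_simps)
  ultimately have "A' = 0" "B' = 0" unfolding eq by simp_all
  then have "v \<in> zero_locus (const3 \<alpha> * A + const3 \<beta> * B)" for \<alpha> \<beta>
    using v by (simp add: zero_locus_def A'_def B'_def)
  then have "v \<in> (\<Inter>G\<in>\<P>. zero_locus G)" unfolding pencil by blast
  moreover have "(\<Inter>G\<in>\<P>. zero_locus G) = {v. same_point v p}"
    using P by (simp only: hyperosculating_pencil_def)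
  ultimately show ?thesis by blast
qed

lemma smooth_conicD:
  assumes "smooth_conic G"
  shows "homogeneous3 2 G" and "v \<noteq> 0 \<Longrightarrow> eval3 G v = 0 \<Longrightarrow> grad_at G v \<noteq> 0"
  using assms by (auto simp: smooth_conic_def plane_curve_def zero_locus_def grad_at_def vec_eq_iff)

text \<open>The basis consists of a multiple of the point \<open>a\<close> where the tangent \<open>L\<^sub>1\<close> touches \<open>Q\<^sub>1\<close>, the
  point \<open>q\<close> and the base point \<open>p\<close>.\<close>

lemma adapted_basis:
  assumes Q: "smooth_conic Q" and L0: "tangent_at L0 Q p"
    and q: "q \<in> zero_locus L0" "\<not> same_point q p"
    and L: "tangent_line L Q" "q \<in> zero_locus L" "\<not> same_curve L L0"
  obtains e \<mu> where "dot3 e (cross q p) \<noteq> 0" "\<mu> \<noteq> 0"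
    "\<And>x y z. eval3 Q (x *s e + y *s q + z *s p) = \<mu> * (y * y + x * z)"
proof -
  note hom = smooth_conicD(1)[OF Q]
  obtain a where a: "tangent_at L Q a" using L(1) by (auto simp: tangent_line_def)
  obtain c where c: "c \<noteq> 0" "L0 = lin (c *s grad_at Q p)" using L0 by (auto simp: tangent_at_iff)
  obtain c' where c': "c' \<noteq> 0" "L = lin (c' *s grad_at Q a)" using a by (auto simp: tangent_at_iff)
  have p0: "eval3 Q p = 0" "p \<noteq> 0" and a0: "eval3 Q a = 0" "a \<noteq> 0" and q0: "q \<noteq> 0"
    using L0 a q by (auto simp: tangent_at_iff zero_locus_def)
  have pq: "dot3 (grad_at Q p) q = 0" and aq: "dot3 (grad_at Q a) q = 0"
    using q(1) L(2) c c' by (simp_all add: zero_locus_def dot3_scale_left)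
  have pp: "dot3 (grad_at Q p) p = 0" and aa: "dot3 (grad_at Q a) a = 0"
    using grad_at_diagonal[OF hom] p0 a0 by simp_all
  have cross: "cross q p \<noteq> 0" using cross_zero_same_point[OF _ q0 p0(2)] q(2) by blast
  have gp: "same_point (grad_at Q p) (cross q p)"
    using orthogonal_to_two[OF pp pq _ cross] smooth_conicD(2)[OF Q] p0 by blast
  \<comment> \<open>The polar pairing of \<open>a\<close> and \<open>p\<close>; were it zero, both
    tangents would be the line through \<open>p\<close> and \<open>q\<close>.\<close>
  define \<nu> where "\<nu> = dot3 (grad_at Q a) p"
  have \<nu>: "\<nu> \<noteq> 0"
  proof
    assume "\<nu> = 0"
    then have "same_point (grad_at Q a) (cross q p)"
      using orthogonal_to_two[OF _ aq _ cross] smooth_conicD(2)[OF Q] a0 by (simp add: \<nu>_def)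
    then obtain s s' where "s \<noteq> 0" "s' \<noteq> 0" "grad_at Q a = s *s cross q p" "grad_at Q p = s' *s cross q p"
      using gp by (auto simp: same_point_def)
    then have "grad_at Q a = (s / s') *s grad_at Q p" "s / s' \<noteq> 0" by (simp_all add: vec_eq_iff)
    then have "L = const3 (c' * (s / s') / c) * L0" "c' * (s / s') / c \<noteq> 0"
      using c c' by (simp_all add: lin_scale mult.assoc[symmetric])
    then show False using L(3) unfolding same_curve_def by blast
  qed
  \<comment> \<open>Symmetry of the polar form expresses \<open>\<nu>\<close> through the
    determinant of \<open>a\<close>, \<open>q\<close>, \<open>p\<close>, so these form a
    basis.\<close>
  obtain s where "grad_at Q p = s *s cross q p" using gp by (auto simp: same_point_def)
  then have "\<nu> = s * dot3 a (cross q p)"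
    unfolding \<nu>_def grad_at_symmetric[OF hom, of a p] by (simp only: dot3_scale_left dot3_commute[of a "cross q p"])
  then have da: "dot3 a (cross q p) \<noteq> 0" using \<nu> by auto
  \<comment> \<open>If \<open>q\<close> lay on the conic, its gradient there would vanish on the
    whole basis, contradicting smoothness.\<close>
  define \<mu> where "\<mu> = eval3 Q q"
  have \<mu>: "\<mu> \<noteq> 0"
  proof
    assume "\<mu> = 0"
    then have "grad_at Q q = 0"
      using grad_at_symmetric[OF hom, of q a] grad_at_symmetric[OF hom, of q p] pq aq grad_at_diagonal[OF hom, of q]
      by (intro orthogonal_to_basis[OF da]) (simp_all add: \<mu>_def)
    then show False using smooth_conicD(2)[OF Q q0] \<open>\<mu> = 0\<close> by (simp add: \<mu>_def)
  qed
  \<comment> \<open>Scaling \<open>a\<close> by \<open>\<mu> / \<nu>\<close> makes the coefficients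
    of \<open>x * z\<close> and \<open>y * y\<close> agree.\<close>
  have "eval3 Q (x *s ((\<mu> / \<nu>) *s a) + y *s q + z *s p) = \<mu> * (y * y + x * z)" for x y z
  proof -
    have "eval3 Q (x *s ((\<mu> / \<nu>) *s a) + y *s q + z *s p)
        = eval3 Q ((x * (\<mu> / \<nu>)) *s a + y *s q + z *s p)" by simp
    also have "\<dots> = \<mu> * (y * y + x * z)"
      unfolding eval3_quadratic[OF hom] using \<nu> grad_at_symmetric[OF hom, of q p]
      by (simp add: a0 p0 aq pq \<mu>_def[symmetric] \<nu>_def[symmetric] algebra_simps)
    finally show ?thesis .
  qed
  moreover have "dot3 ((\<mu> / \<nu>) *s a) (cross q p) \<noteq> 0" using \<mu> \<nu> da by (simp add: dot3_scale_left)
  ultimately show ?thesis using that \<mu> by blast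
qed

text \<open>Subtracting a multiple of the first conic \<open>G\<close> removes the \<open>X Z\<close> term of \<open>H\<close>. Any zero with \<open>X = 1\<close> of
  the remaining form \<open>A Y\<^sup>2 + B X Y + D X\<^sup>2\<close> would give a second base point.\<close>

lemma pencil_member_normal_form:
  assumes P: "hyperosculating_pencil \<P> p" and G: "G \<in> \<P>" and H: "H \<in> \<P>" "smooth_conic H"
    and tangent: "tangent_at L0 H p" "q \<in> zero_locus L0"
    and d: "dot3 e (cross q p) \<noteq> 0" and \<mu>: "\<mu> \<noteq> 0"
    and G_eval: "\<And>x y z. eval3 G (x *s e + y *s q + z *s p) = \<mu> * (y * y + x * z)"
  obtains c t where "c \<noteq> 0"
    "\<And>x y z. eval3 H (x *s e + y *s q + z *s p) = c * (y * y + x * (z + t * x))"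
proof (cases "same_curve H G")
  \<comment> \<open>Here \<open>H\<close> is a multiple of \<open>G\<close>, so
    \<open>t = 0\<close>; \<open>pencil_base_point\<close> applies only to different curves.\<close>
  case True
  then obtain k where "k \<noteq> 0" "H = const3 k * G" by (auto simp: same_curve_def)
  then show ?thesis using that[of "k * \<mu>" 0] \<mu> by (simp add: G_eval)
next
  case False
  note hom = smooth_conicD(1)[OF H(2)]
  obtain c\<^sub>0 where c\<^sub>0: "c\<^sub>0 \<noteq> 0" "L0 = lin (c\<^sub>0 *s grad_at H p)" using tangent by (auto simp: tangent_at_iff)
  have p0: "eval3 H p = 0" "p \<noteq> 0" using tangent by (auto simp: tangent_at_iff zero_locus_def)
  have pq: "dot3 (grad_at H p) q = 0" using tangent(2) c\<^sub>0 by (simp add: zero_locus_def dot3_scale_left)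
  have pp: "dot3 (grad_at H p) p = 0" using grad_at_diagonal[OF hom] p0 by simp
  \<comment> \<open>Were this zero, the gradient of \<open>H\<close> at \<open>p\<close> would
    vanish on the whole basis.\<close>
  define \<nu> where "\<nu> = dot3 (grad_at H e) p"
  have \<nu>: "\<nu> \<noteq> 0"
  proof
    assume "\<nu> = 0"
    then have "grad_at H p = 0"
      using grad_at_symmetric[OF hom, of e p] pq pp by (intro orthogonal_to_basis[OF d]) (simp_all add: \<nu>_def)
    then show False using smooth_conicD(2)[OF H(2)] p0 by blast
  qed
  define \<alpha> \<beta> \<rho> where "\<alpha> = eval3 H q" and "\<beta> = dot3 (grad_at H e) q" and "\<rho> = eval3 H e"
  have H_eval: "eval3 H (x *s e + y *s q + z *s p) = \<rho> * x * x + \<alpha> * y * y + \<beta> * x * y + \<nu> * x * z"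
    for x y z
    unfolding eval3_quadratic[OF hom] using grad_at_symmetric[OF hom, of q p] p0 pq
    by (simp add: \<alpha>_def[symmetric] \<beta>_def[symmetric] \<nu>_def[symmetric] \<rho>_def[symmetric] algebra_simps)
  have "(\<alpha> - \<nu>) * (y * y) + \<beta> * y + \<rho> \<noteq> 0" for y
  proof
    assume root: "(\<alpha> - \<nu>) * (y * y) + \<beta> * y + \<rho> = 0"
    \<comment> \<open>With \<open>x = 1\<close>, the point lies on \<open>G\<close> exactly when
      \<open>z = - (y * y)\<close>.\<close>
    define v where "v = 1 *s e + y *s q + (- (y * y)) *s p"
    \<comment> \<open>Pairing with \<open>cross q p\<close> measures the \<open>X\<close>
      coordinate, which is nonzero at \<open>v\<close> but zero at \<open>p\<close>.\<close>
    have dv: "dot3 v (cross q p) = dot3 e (cross q p)" "dot3 p (cross q p) = 0"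
      unfolding v_def by (simp_all add: dot3_def cross_nth algebra_simps)
    then have "v \<noteq> 0" using d by (auto simp: dot3_def)
    moreover have "eval3 G v = 0" unfolding v_def G_eval by simp
    moreover have "eval3 H v = 0" unfolding v_def H_eval using root by (simp add: algebra_simps)
    ultimately have "same_point v p"
      using pencil_base_point[OF P H(1) G False, of v] by (simp add: zero_locus_def)
    then show False using dv d by (auto simp: same_point_def dot3_scale_left)
  qed
  then have "\<alpha> = \<nu>" and "\<beta> = 0" using quadratic_no_root[of "\<alpha> - \<nu>" \<beta> \<rho>] by auto
  define t where "t = \<rho> / \<nu>"
  have "\<rho> = \<nu> * t" using \<nu> by (simp add: t_def)
  then have "eval3 H (x *s e + y *s q + z *s p) = \<nu> * (y * y + x * (z + t * x))" for x y z
    unfolding H_eval \<open>\<alpha> = \<nu>\<close> \<open>\<beta> = 0\<close> by (simp add: algebra_simps)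
  then show ?thesis using that[of \<nu> t] \<nu> by blast
qed

text \<open>The functional \<open>grad_at G a\<close> at a point \<open>a = (x, y, z)\<close> of the conic is
  \<open>(z + 2 t x) X + 2 y Y + x Z\<close>. It vanishes at \<open>q = (0, 1, 0)\<close> iff \<open>y = 0\<close>, and then \<open>x (z + t x) = 0\<close>.\<close>

lemma second_tangent:
  assumes G: "G = const3 c * (lin b * lin b + lin a * (lin g + const3 t * lin a))" "c \<noteq> 0"
    and q: "dot3 a q = 0" "dot3 b q = 1" "dot3 g q = 0"
    and L: "tangent_line L G" "q \<in> zero_locus L" "\<not> same_curve L (lin a)"
  obtains d where "d \<noteq> 0" "L = const3 d * (lin g + const3 t * lin a)"
proof -
  obtain v where v: "tangent_at L G v" using L(1) by (auto simp: tangent_line_def)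
  then obtain s where s: "s \<noteq> 0" "L = lin (s *s grad_at G v)" and G0: "eval3 G v = 0" and "L \<noteq> 0"
    by (auto simp: tangent_at_iff zero_locus_def plane_curve_def)
  define x y z where "x = dot3 a v" and "y = dot3 b v" and "z = dot3 g v"
  have grad: "grad_at G v = (c * (z + 2 * t * x)) *s a + (2 * c * y) *s b + (c * x) *s g"
    by (simp add: G(1) grad_at_def vec_eq_iff x_def y_def z_def algebra_simps)
  have "dot3 (s *s grad_at G v) q = s * (2 * c * y)"
    using q unfolding grad by (simp add: dot3_add_left dot3_scale_left)
  then have "y = 0" using L(2) s G(2) by (simp add: zero_locus_def)
  moreover have "c * (y * y + x * (z + t * x)) = 0"
    using G0 by (simp add: G(1) x_def y_def z_def)
  ultimately have xz: "x = 0 \<or> z + t * x = 0" using G(2) by simp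
  show ?thesis
  proof (cases "x = 0")
    \<comment> \<open>A contact point on \<open>X = 0\<close> yields the excluded tangent
      \<open>lin a\<close>.\<close>
    case True
    then have "L = const3 (s * (c * z)) * lin a"
      unfolding s(2) grad using \<open>y = 0\<close> by (simp add: lin_scale mult.assoc[symmetric])
    moreover from this have "s * (c * z) \<noteq> 0" using \<open>L \<noteq> 0\<close> by auto
    ultimately show ?thesis using L(3) unfolding same_curve_def by blast
  next
    case False
    then have "z = - (t * x)" using xz by (simp add: eq_neg_iff_add_eq_0)
    then have "s *s grad_at G v = (s * c * x) *s (g + t *s a)"
      unfolding grad using \<open>y = 0\<close> by (simp add: vec_eq_iff algebra_simps)
    then have "L = const3 (s * c * x) * (lin g + const3 t * lin a)"
      unfolding s(2) by (simp only: lin_scale lin_add)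
    moreover have "s * c * x \<noteq> 0" using False s G(2) by simp
    ultimately show ?thesis using that by blast
  qed
qed

section \<open>Reduction of the given arrangement to the normal form\<close>

theorem proposition7p2:
  fixes m :: nat and \<P> :: "S set" and Q L :: "nat \<Rightarrow> S" and p q :: "complex ^ 3"
  assumes "m \<ge> 2"
    and "hyperosculating_pencil \<P> p"
    and "\<forall>k\<in>{1..m}. Q k \<in> \<P> \<and> smooth_conic (Q k)"
    and "\<forall>k\<in>{1..m}. \<forall>l\<in>{1..m}. k \<noteq> l \<longrightarrow> \<not> same_curve (Q k) (Q l)"
    and "\<forall>k\<in>{1..m}. tangent_at (L 0) (Q k) p"
    and "q \<in> zero_locus (L 0)" and "\<not> same_point q p"
    and "\<forall>k\<in>{1..m}. tangent_line (L k) (Q k) \<and> q \<in> zero_locus (L k) \<and>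
           \<not> same_curve (L k) (L 0)"
  shows "\<forall>j\<in>{2..m+1}.
           let F = (\<Prod>k=1..m. Q k) * L 0 * (\<Prod>k=1..j-1. L k) in
             zero_locus F = (\<Union>k\<in>{1..m}. zero_locus (Q k)) \<union> zero_locus (L 0) \<union>
                              (\<Union>k\<in>{1..j-1}. zero_locus (L k)) \<and>
             free_curve F \<and> plane_curve (2 * m + j) F \<and> mdr F = j"
proof -
  have one: "1 \<in> {1..m}" using assms(1) by simp
  \<comment> \<open>The first conic and its tangent from \<open>q\<close> fix the coordinates in
    which the other conics are then normalized.\<close>
  obtain e \<mu> where e: "dot3 e (cross q p) \<noteq> 0" "\<mu> \<noteq> 0"
    "\<And>x y z. eval3 (Q 1) (x *s e + y *s q + z *s p) = \<mu> * (y * y + x * z)"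
    using adapted_basis[of "Q 1" "L 0" p q "L 1"] assms one by metis
  define d where "d = dot3 e (cross q p)"
  define a b g where "a = (1 / d) *s cross q p" and "b = (1 / d) *s cross p e" and "g = (1 / d) *s cross e q"
  have d: "dot3 e (cross q p) = d" "d \<noteq> 0" using e(1) by (simp_all add: d_def)
  interpret frame "lin a" "lin b" "lin g" e q p
    unfolding a_def b_def g_def by (rule frame_of_basis[OF d])
  have dual_q: "dot3 a q = 0" "dot3 b q = 1" "dot3 g q = 0"
    and dual_p: "dot3 a p = 0" "dot3 b p = 0" "dot3 g p = 1"
    using dual unfolding der_const_vec_lin const3_simps(2)[symmetric] const3_eq_iff
    by (simp_all add: dot3_commute[of q] dot3_commute[of p])

  have "\<forall>k\<in>{1..m}. \<exists>c t. c \<noteq> 0 \<and> Q k = const3 c * conic t"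
  proof
    fix k assume k: "k \<in> {1..m}"
    obtain c t where c: "c \<noteq> 0"
        "\<And>x y z. eval3 (Q k) (x *s e + y *s q + z *s p) = c * (y * y + x * (z + t * x))"
      using pencil_member_normal_form[OF assms(2) _ _ _ _ assms(6) e, of "Q k"] assms k one by metis
    have "Q k = const3 c * conic t"
    proof (rule eval3_eqI)
      fix v
      have "eval3 (Q k) v = eval3 (Q k) (dot3 a v *s e + dot3 b v *s q + dot3 g v *s p)"
        using cramer3[OF d, of v] by (simp only: a_def b_def g_def)
      also have "\<dots> = eval3 (const3 c * conic t) v" unfolding c by (simp add: conic_def line_def)
      finally show "eval3 (Q k) v = eval3 (const3 c * conic t) v" .
    qed
    then show "\<exists>c t. c \<noteq> 0 \<and> Q k = const3 c * conic t" using c by blast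
  qed
  then obtain c t where Q: "\<And>k. k \<in> {1..m} \<Longrightarrow> c k \<noteq> 0 \<and> Q k = const3 (c k) * conic (t k)"
    by metis
  have inj: "inj_on t {1..m}"
  proof (rule inj_onI, rule ccontr)
    fix k l assume kl: "k \<in> {1..m}" "l \<in> {1..m}" "t k = t l" "k \<noteq> l"
    then have "Q k = const3 (c k / c l) * Q l" "c k / c l \<noteq> 0"
      using Q[OF kl(1)] Q[OF kl(2)] by (simp_all add: mult.assoc[symmetric])
    then show False using assms(4) kl unfolding same_curve_def by blast
  qed

  have "tangent_at (L 0) (Q 1) p" using assms(5) one by blast
  then obtain s where s: "s \<noteq> 0" "L 0 = lin (s *s grad_at (Q 1) p)" by (auto simp: tangent_at_iff)
  \<comment> \<open>At \<open>p\<close> the coordinates \<open>X\<close> and \<open>Y\<close> vanish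
    and \<open>Z\<close> is 1, so only the term \<open>X * Z\<close> contributes.\<close>
  have "grad_at (Q 1) p = c 1 *s a"
    using Q[OF one] dual_p by (simp add: grad_at_def vec_eq_iff conic_def line_def)
  then have "L 0 = const3 (s * c 1) * lin a" "s * c 1 \<noteq> 0"
    using s Q[OF one] by (simp_all add: lin_scale mult.assoc[symmetric])
  then obtain d\<^sub>0 where d\<^sub>0: "d\<^sub>0 \<noteq> 0" "L 0 = const3 d\<^sub>0 * lin a" by metis
  have "\<forall>k\<in>{1..m}. \<exists>d. d \<noteq> 0 \<and> L k = const3 d * line (t k)"
  proof
    fix k assume k: "k \<in> {1..m}"
    have "\<not> same_curve (L k) (lin a)"
    proof
      assume "same_curve (L k) (lin a)"
      then obtain r where "r \<noteq> 0" "L k = const3 r * lin a" by (auto simp: same_curve_def)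
      then have "L k = const3 (r / d\<^sub>0) * L 0" "r / d\<^sub>0 \<noteq> 0"
        using d\<^sub>0 by (simp_all add: mult.assoc[symmetric])
      then show False using assms(8) k unfolding same_curve_def by blast
    qed
    then show "\<exists>d. d \<noteq> 0 \<and> L k = const3 d * line (t k)"
      using second_tangent[of "Q k" "c k" b a g "t k" q "L k"] Q[OF k] dual_q assms(8) k
      unfolding conic_def line_def by metis
  qed
  then obtain d' where L: "\<And>k. k \<in> {1..m} \<Longrightarrow> d' k \<noteq> 0 \<and> L k = const3 (d' k) * line (t k)"
    by metis

  show ?thesis
  proof
    fix j assume j: "j \<in> {2..m+1}"
    define J C where "J = j - 1" and "C = (\<Prod>k=1..m. c k) * d\<^sub>0 * (\<Prod>k=1..J. d' k)"
    have J_eq: "1 \<le> J" "J \<le> m" "j = Suc J" using j by (auto simp: J_def)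
    have "C \<noteq> 0" using Q L d\<^sub>0 J_eq by (auto simp: C_def)
    then interpret arrangement "lin a" "lin b" "lin g" e q p m J t C
      using J_eq inj by unfold_locales auto
    have "(\<Prod>k=1..m. Q k) = (\<Prod>k=1..m. const3 (c k) * conic (t k))" using Q by (intro prod.cong) auto
    moreover have "(\<Prod>k=1..J. L k) = (\<Prod>k=1..J. const3 (d' k) * line (t k))" using L J_eq by (intro prod.cong) auto
    moreover have "const3 C = (\<Prod>k=1..m. const3 (c k)) * const3 d\<^sub>0 * (\<Prod>k=1..J. const3 (d' k))"
      unfolding C_def const3_prod[symmetric] const3_simps ..
    ultimately have F: "(\<Prod>k=1..m. Q k) * L 0 * (\<Prod>k=1..J. L k) = F"
      unfolding F_def d\<^sub>0(2) prod.distrib by (simp only: ac_simps)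
    have "plane_curve (2 * m + j) F" using F_nz hom_F by (simp add: plane_curve_def J_eq(3))
    moreover have "zero_locus F = (\<Union>k\<in>{1..m}. zero_locus (Q k)) \<union> zero_locus (L 0) \<union>
        (\<Union>k\<in>{1..J}. zero_locus (L k))"
      unfolding F[symmetric] by (simp only: zero_locus_mult zero_locus_prod finite_atLeastAtMost)
    ultimately show "let F = (\<Prod>k=1..m. Q k) * L 0 * (\<Prod>k=1..j-1. L k) in
        zero_locus F = (\<Union>k\<in>{1..m}. zero_locus (Q k)) \<union> zero_locus (L 0) \<union>
          (\<Union>k\<in>{1..j-1}. zero_locus (L k)) \<and>
        free_curve F \<and> plane_curve (2 * m + j) F \<and> mdr F = j"
      unfolding Let_def J_def[symmetric] F using free_curve mdr_F[OF assms(1)] J_eq(3) by simp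
  qed
qed

end
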